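(* Let $0<\alpha<1$. For $t\ge 0$, the state probability $p_0^\alpha(t)$ of the time-changed Erlang queue with multiple arrivals $\{\mathcal{Q}^\alpha(t)\}_{t\ge0}$ is given by $$p_0^\alpha(t)=\sum_{h=1}^{\infty}\sum_{n=0}^{\infty}\sum_{\substack{m_1+\dots+m_l=n\\ m_j\ge 0}}C^0_{h,n}(\mathbf{m})\,t^{\beta^0_{h,n}(\mathbf{m})-1}E^{\gamma^0_{h,n}(\mathbf{m})}_{\alpha,\beta^0_{h,n}(\mathbf{m})}\big(-(\lambda+k\mu)t^\alpha\big),$$ where, for $\mathbf{m}=(m_1,\dots,m_l)$ with $m_j\in\mathbb{N}_0$, $$\gamma^0_{h,n}(\mathbf{m})=h+n+k\sum_{j=1}^{l}jm_j,\qquad \beta^0_{h,n}(\mathbf{m})=\alpha\big(\gamma^0_{h,n}(\mathbf{m})-1\big)+1,$$ $$C^0_{h,n}(\mathbf{m})=h\lambda^n\Big(\prod_{i=1}^{l}\frac{c_i^{m_i}}{m_i!}\Big)\frac{(k\mu)^{\gamma^0_{h,n}(\mathbf{m})-n-1}}{(\gamma^0_{h,n}(\mathbf{m})-n)!}\,(\gamma^0_{h,n}(\mathbf{m})-1)!,$$ and $E^{\gamma}_{\alpha,\beta}(\cdot)$ is the three-parameter Mittag-Leffler function.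
   Context: Let $k,l\ge 1$ be integers, $\mu>0$, $\lambda_1,\dots,\lambda_l>0$, $\lambda=\lambda_1+\dots+\lambda_l$ and $c_m=\lambda_m/\lambda$ for $1\le m\le l$. $\mathbb{N}_0=\{0,1,2,\dots\}$. The Erlang queue with multiple arrivals is the continuous-time Markov process $\mathcal{Q}(t)=(\mathcal{N}(t),\mathcal{S}(t))$, $t\ge 0$, on the state space $\mathcal{H}_0=\mathcal{H}\cup\{(0,0)\}$, $\mathcal{H}=\{(n,s)\in\mathbb{N}\times\mathbb{N}: n\ge 1,\ 1\le s\le k\}$, with $\mathcal{Q}(0)=(0,0)$. Here $\mathcal{N}(t)$ is the number of customers in a single-channel system and $\mathcal{S}(t)$ is the phase of the customer in service (each service starts in phase $k$, and the phases are counted down to $1$), with $\mathcal{S}(t)=0$ if $\mathcal{N}(t)=0$. Its nonzero transition rates (an event of rate $q$ has probability $qh+o(h)$ in an interval of length $h$) are, for $1\le m\le l$: (arrivals) $(0,0)\to(m,k)$ at rate $\lambda_m=\lambda c_m$, and $(n,s)\to(n+m,s)$ at rate $\lambda_m=\lambda c_m$ for $(n,s)\in\mathcal{H}$; (service, each phase being exponential with mean $1/(k\mu)$) at rate $k\mu$: $(n,s)\to(n,s-1)$ for $n\ge1$, $2\le s\le k$; $(n,1)\to(n-1,k)$ for $n\ge 2$; and $(1,1)\to(0,0)$. For $0<\alpha<1$ let $\{D_\alpha(t)\}_{t\ge0}$ be an $\alpha$-stable subordinator, i.e. the one-dimensional non-decreasing Lévy process with $\mathbb{E}(e^{-zD_\alpha(t)})=e^{-tz^\alpha}$,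 $z>0$, and let $Y_\alpha(t)=\inf\{s\ge 0: D_\alpha(s)>t\}$ be its first hitting time (inverse $\alpha$-stable subordinator), taken independent of $\mathcal{Q}$. The time-changed Erlang queue with multiple arrivals is $\mathcal{Q}^\alpha(t)=\mathcal{Q}(Y_\alpha(t))$, $t\ge0$, and $p^\alpha_0(t)=\Pr(\mathcal{Q}^\alpha(t)=(0,0)\mid\mathcal{Q}^\alpha(0)=(0,0))$. The three-parameter Mittag-Leffler function is $E^{\gamma}_{\alpha,\beta}(t)=\sum_{r=0}^{\infty}\frac{\Gamma(\gamma+r)\,t^r}{r!\,\Gamma(\gamma)\,\Gamma(\alpha r+\beta)}$ for $\alpha,\beta,\gamma>0$. Convention: $0^0=1$. *)

theory Defs
  imports "HOL-Probability.Probability" "HOL-Library.Landau_Symbols"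
begin

definition transition_semigroup :: "'s set \<Rightarrow> (real \<Rightarrow> 's \<Rightarrow> 's pmf) \<Rightarrow> bool" where
  "transition_semigroup S P \<longleftrightarrow>
     (\<forall>x\<in>S. P 0 x = return_pmf x) \<and>
     (\<forall>h\<ge>0. \<forall>x\<in>S. set_pmf (P h x) \<subseteq> S) \<and>
     (\<forall>g\<ge>0. \<forall>h\<ge>0. \<forall>x\<in>S. P (g + h) x = bind_pmf (P g x) (P h))"

text \<open>
  Infinitesimal description by the off-diagonal rates \<open>q x y\<close>: over an interval of length \<open>h\<close>,
  a jump from \<open>x\<close> to \<open>y\<close> has probability \<open>q x y * h + o(h)\<close>, and no jump occurs
  with the complementary probability \<open>1 - (\<Sum>y. q x y) * h + o(h)\<close>. The values \<open>q x x\<close> are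
  not used.
\<close>

definition has_transition_rates ::
    "'s set \<Rightarrow> ('s \<Rightarrow> 's \<Rightarrow> real) \<Rightarrow> (real \<Rightarrow> 's \<Rightarrow> 's pmf) \<Rightarrow> bool" where
  "has_transition_rates S q P \<longleftrightarrow>
     (\<forall>x\<in>S. \<forall>y\<in>S. x \<noteq> y \<longrightarrow>
        (\<lambda>h. pmf (P h x) y - q x y * h) \<in> o[at_right 0](\<lambda>h. h)) \<and>
     (\<forall>x\<in>S.
        (\<lambda>h. pmf (P h x) x - (1 - (\<Sum>\<^sub>\<infinity>y\<in>S - {x}. q x y) * h)) \<in> o[at_right 0](\<lambda>h. h))"

text \<open>
  Only times \<open>t \<ge> 0\<close> are meaningful. The paths are almost surely right-continuous for the
  discrete topology on \<open>S\<close>, as usual for jump processes; without path regularity the value of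
  the process at a random time would not be determined by its law.
\<close>

definition markov_jump_process ::
    "'w measure \<Rightarrow> 's set \<Rightarrow> ('s \<Rightarrow> 's \<Rightarrow> real) \<Rightarrow> 's \<Rightarrow> (real \<Rightarrow> 'w \<Rightarrow> 's) \<Rightarrow> bool" where
  "markov_jump_process M S q x0 X \<longleftrightarrow>
     (\<forall>t\<ge>0. X t \<in> measurable M (count_space S)) \<and>
     (AE \<omega> in M. X 0 \<omega> = x0) \<and>
     (AE \<omega> in M. \<forall>t\<ge>0. \<forall>\<^sub>F s in at_right t. X s \<omega> = X t \<omega>) \<and>
     (\<exists>P. transition_semigroup S P \<and> has_transition_rates S q P \<and>
        (\<forall>(n::nat) (\<tau>::nat \<Rightarrow> real) x h y.
           0 \<le> \<tau> 0 \<and> strict_mono \<tau> \<and> 0 \<le> h \<and> \<P>(\<omega> in M. \<forall>i\<le>n. X (\<tau> i) \<omega> = x i) > 0 \<longrightarrow>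
           \<P>(\<omega> in M. X (\<tau> n + h) \<omega> = y \<bar> \<forall>i\<le>n. X (\<tau> i) \<omega> = x i) = pmf (P h (x n)) y))"

text \<open>A state \<open>(n, s)\<close> records the number of customers and the phase of the one in service.\<close>

definition erlang_states :: "nat \<Rightarrow> (nat \<times> nat) set" where
  "erlang_states k = insert (0, 0) {(n, s). 1 \<le> n \<and> 1 \<le> s \<and> s \<le> k}"

fun arrival :: "nat \<Rightarrow> nat \<Rightarrow> nat \<times> nat \<Rightarrow> nat \<times> nat" where
  "arrival k m (n, s) = (if n = 0 then (m, k) else (n + m, s))"

fun service :: "nat \<Rightarrow> nat \<times> nat \<Rightarrow> nat \<times> nat" where
  "service k (n, s) = (if 2 \<le> s then (n, s - 1) else if 2 \<le> n then (n - 1, k) else (0, 0))"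

definition erlang_rate ::
    "nat \<Rightarrow> nat \<Rightarrow> real \<Rightarrow> (nat \<Rightarrow> real) \<Rightarrow> nat \<times> nat \<Rightarrow> nat \<times> nat \<Rightarrow> real" where
  "erlang_rate k l \<mu> lam x y =
     (\<Sum>m=1..l. if y = arrival k m x then lam m else 0) +
     (if x \<noteq> (0, 0) \<and> y = service k x then real k * \<mu> else 0)"

definition erlang_queue ::
    "'w measure \<Rightarrow> nat \<Rightarrow> nat \<Rightarrow> real \<Rightarrow> (nat \<Rightarrow> real) \<Rightarrow> (real \<Rightarrow> 'w \<Rightarrow> nat \<times> nat) \<Rightarrow> bool" where
  "erlang_queue M k l \<mu> lam X \<longleftrightarrow>
     markov_jump_process M (erlang_states k) (erlang_rate k l \<mu> lam) (0, 0) X"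

definition levy_process :: "'w measure \<Rightarrow> (real \<Rightarrow> 'w \<Rightarrow> real) \<Rightarrow> bool" where
  "levy_process M D \<longleftrightarrow>
     (\<forall>t\<ge>0. D t \<in> borel_measurable M) \<and>
     (AE \<omega> in M. D 0 \<omega> = 0) \<and>
     (\<forall>(n::nat) (\<tau>::nat \<Rightarrow> real). 0 \<le> \<tau> 0 \<and> strict_mono \<tau> \<longrightarrow>
        prob_space.indep_vars M (\<lambda>_. borel) (\<lambda>i \<omega>. D (\<tau> (Suc i)) \<omega> - D (\<tau> i) \<omega>) {..<n}) \<and>
     (\<forall>s\<ge>0. \<forall>t\<ge>0.
        distr M borel (\<lambda>\<omega>. D (s + t) \<omega> - D s \<omega>) = distr M borel (\<lambda>\<omega>. D t \<omega> - D 0 \<omega>)) \<and>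
     (\<forall>t\<ge>0. \<forall>\<epsilon>>0.
        ((\<lambda>s. \<P>(\<omega> in M. \<bar>D s \<omega> - D t \<omega>\<bar> > \<epsilon>)) \<longlongrightarrow> 0) (at t within {0..}))"

definition stable_subordinator :: "'w measure \<Rightarrow> real \<Rightarrow> (real \<Rightarrow> 'w \<Rightarrow> real) \<Rightarrow> bool" where
  "stable_subordinator M \<alpha> D \<longleftrightarrow>
     levy_process M D \<and>
     (AE \<omega> in M. mono_on {0..} (\<lambda>t. D t \<omega>)) \<and>
     (\<forall>t\<ge>0. \<forall>z>0. (\<integral>\<omega>. exp (- z * D t \<omega>) \<partial>M) = exp (- t * z powr \<alpha>))"

text \<open>
  For a stable subordinator \<open>D\<close>, the set under the infimum is nonempty almost surely; on the
  exceptional null set the value is immaterial.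
\<close>

definition first_hitting :: "(real \<Rightarrow> 'w \<Rightarrow> real) \<Rightarrow> real \<Rightarrow> 'w \<Rightarrow> real" where
  "first_hitting D t \<omega> = Inf {s. 0 \<le> s \<and> D s \<omega> > t}"

definition time_change :: "(real \<Rightarrow> 'w \<Rightarrow> 's) \<Rightarrow> (real \<Rightarrow> 'w \<Rightarrow> real) \<Rightarrow> real \<Rightarrow> 'w \<Rightarrow> 's" where
  "time_change X Y t \<omega> = X (Y t \<omega>) \<omega>"

text \<open>
  Since path properties are only required almost surely, first hitting times and time-changed
  processes are measurable only up to null sets. Independence and probabilities that involve them
  are therefore taken in the completion of \<open>M\<close>.
\<close>

definition process_events ::
    "'w measure \<Rightarrow> 'a measure \<Rightarrow> (real \<Rightarrow> 'w \<Rightarrow> 'a) \<Rightarrow> 'w set set" where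
  "process_events M A X =
     sigma_sets (space M) (\<Union>t\<in>{0..}. {X t -` B \<inter> space M | B. B \<in> sets A})"

definition independent_processes ::
    "'w measure \<Rightarrow> 'a measure \<Rightarrow> (real \<Rightarrow> 'w \<Rightarrow> 'a) \<Rightarrow> 'b measure \<Rightarrow> (real \<Rightarrow> 'w \<Rightarrow> 'b) \<Rightarrow> bool" where
  "independent_processes M A X B Y \<longleftrightarrow>
     prob_space.indep_set (completion M) (process_events M A X) (process_events M B Y)"

definition zero_state_prob :: "'w measure \<Rightarrow> (real \<Rightarrow> 'w \<Rightarrow> nat \<times> nat) \<Rightarrow> real \<Rightarrow> real" where
  "zero_state_prob M X t = \<P>(\<omega> in completion M. X t \<omega> = (0, 0) \<bar> X 0 \<omega> = (0, 0))"

definition mittag_leffler3 :: "real \<Rightarrow> real \<Rightarrow> real \<Rightarrow> real \<Rightarrow> real" where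
  "mittag_leffler3 \<alpha> \<beta> \<gamma> t =
     (\<Sum>r. Gamma (\<gamma> + real r) * t ^ r / (fact r * Gamma \<gamma> * Gamma (\<alpha> * real r + \<beta>)))"

text \<open>Real powers with the convention \<open>0\<^sup>0 = 1\<close>, whereas \<open>0 powr 0 = 0\<close>.\<close>

definition rpower :: "real \<Rightarrow> real \<Rightarrow> real" where
  "rpower t a = (if a = 0 then 1 else t powr a)"

definition weak_compositions :: "nat \<Rightarrow> nat \<Rightarrow> (nat \<Rightarrow> nat) set" where
  "weak_compositions l n = {m \<in> {1..l} \<rightarrow>\<^sub>E UNIV. (\<Sum>j=1..l. m j) = n}"

definition gamma0 :: "nat \<Rightarrow> nat \<Rightarrow> nat \<Rightarrow> nat \<Rightarrow> (nat \<Rightarrow> nat) \<Rightarrow> nat" where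
  "gamma0 k l h n m = h + n + k * (\<Sum>j=1..l. j * m j)"

definition beta0 :: "nat \<Rightarrow> nat \<Rightarrow> real \<Rightarrow> nat \<Rightarrow> nat \<Rightarrow> (nat \<Rightarrow> nat) \<Rightarrow> real" where
  "beta0 k l \<alpha> h n m = \<alpha> * (real (gamma0 k l h n m) - 1) + 1"

text \<open>The truncated subtractions are exact for \<open>h \<ge> 1\<close>, since then \<open>gamma0 k l h n m \<ge> n + 1\<close>.\<close>

definition coeff0 ::
    "nat \<Rightarrow> nat \<Rightarrow> real \<Rightarrow> (nat \<Rightarrow> real) \<Rightarrow> nat \<Rightarrow> nat \<Rightarrow> (nat \<Rightarrow> nat) \<Rightarrow> real" where
  "coeff0 k l \<mu> lam h n m =
     (let L = (\<Sum>i=1..l. lam i); c = (\<lambda>i. lam i / L); g = gamma0 k l h n m in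
       real h * L ^ n * (\<Prod>i=1..l. c i ^ m i / fact (m i)) *
       ((real k * \<mu>) ^ (g - n - 1) / fact (g - n)) * fact (g - 1))"

definition term0 ::
    "nat \<Rightarrow> nat \<Rightarrow> real \<Rightarrow> (nat \<Rightarrow> real) \<Rightarrow> real \<Rightarrow> real \<Rightarrow> nat \<Rightarrow> nat \<Rightarrow> (nat \<Rightarrow> nat) \<Rightarrow> real" where
  "term0 k l \<mu> lam \<alpha> t h n m =
     coeff0 k l \<mu> lam h n m * rpower t (beta0 k l \<alpha> h n m - 1) *
     mittag_leffler3 \<alpha> (beta0 k l \<alpha> h n m) (real (gamma0 k l h n m))
       (- ((\<Sum>i=1..l. lam i) + real k * \<mu>) * rpower t \<alpha>)"

end

theory Submission
  imports Defs "HOL-Real_Asymp.Real_Asymp"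
begin

text \<open>
  Measure the work in the system in phases of service: with \<open>n\<close> customers, the first of them in
  phase \<open>s\<close>, there are \<open>k * (n - 1) + s\<close> phases left. An arrival of \<open>j\<close> customers adds \<open>k * j\<close>
  phases, and a service removes one. So the number of phases is a walk that goes down by single
  steps and is held at 0: services that occur in the empty state have no effect. The free walk, in
  which they do take effect, makes a new minimum exactly at these services. Hence the queue is empty after \<open>N\<close>
  steps if and only if a further service would bring the free walk, for some \<open>h \<ge> 1\<close>, to the
  level \<open>-h\<close> for the first time. By the hitting-time theorem, a proportion \<open>h / (N + 1)\<close> of the
  orderings of \<open>N + 1\<close> given steps that lead from 0 to \<open>-h\<close> reach \<open>-h\<close> for the first time at
  the end. Counting these orderings by the numbers \<open>m j\<close> of arrivals of each size gives the
  coefficients of the theorem, where \<open>\<gamma>\<close> is the number \<open>N + 1\<close> of steps.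

  In continuous time, let all steps occur at the total rate \<open>c = \<lambda> + k * \<mu>\<close>. The probability that
  the queue is empty at time \<open>t\<close> is then \<open>exp (- c * t)\<close> times the exponential generating function
  of the weights just described (\<open>idle_weight_eq_sum_first_passage\<close>). The process is known only
  through its rates, so this is proved from the backward equations: the rates imply them
  (\<open>kolmogorov_backward\<close>), bounded solutions are unique (\<open>backward_equation_unique_zero\<close>), and the products
  of \<open>exp (- c * t)\<close> with the generating functions form a solution (\<open>erlang_idle_probability\<close>).

  The inverse subordinator \<open>Y t\<close> is independent of the queue, so the probability sought is
  the expectation of the above at the random time \<open>Y t\<close> (\<open>prob_at_independent_time\<close>). By
  self-similarity \<open>Y t\<close> has the law of \<open>t powr \<alpha> * D 1 powr (- \<alpha>)\<close> (\<open>distr_first_hitting\<close>), whose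
  \<open>n\<close>-th moment is \<open>(t powr \<alpha>) ^ n * fact n / Gamma (\<alpha> * n + 1)\<close>. Expanding the exponential
  in \<open>E (Y t ^ N * exp (- c * Y t))\<close> gives \<open>fact N\<close> times
  \<open>(t powr \<alpha>) ^ N\<close> times a Mittag-Leffler function with \<open>\<gamma> = N + 1\<close> and \<open>\<beta> = \<alpha> * N + 1\<close>
  (\<open>integral_hitting_power_exp\<close>). All terms of the resulting series are nonnegative, so it can be
  arranged by \<open>h\<close>, \<open>n\<close> and \<open>m\<close> (\<open>regroup_series\<close>).
\<close>

section \<open>Backward equations of jump processes\<close>

text \<open>
  The \<open>o(h)\<close> estimates concern single transitions. If \<open>x\<close> has only finitely many targets, they add
  up to an estimate in total variation: up to \<open>o(h)\<close> the mass on \<open>x\<close> and its targets is 1, hence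
  the mass elsewhere is \<open>o(h)\<close>. The error \<open>\<epsilon>\<close> is therefore the same for all observables bounded
  by 1, so that the observable may itself depend on \<open>h\<close>.
\<close>

lemma transition_rates_expansion:
  fixes q :: "'s \<Rightarrow> 's \<Rightarrow> real"
  assumes sg: "transition_semigroup S P" and rates: "has_transition_rates S q P"
    and x: "x \<in> S" and F: "finite F" "F \<subseteq> S - {x}"
    and zero: "\<And>y. y \<in> S - {x} - F \<Longrightarrow> q x y = 0"
  obtains \<epsilon> :: "real \<Rightarrow> real" where "((\<lambda>h. \<epsilon> h / h) \<longlongrightarrow> 0) (at_right 0)"
    and "\<And>f h. 0 \<le> h \<Longrightarrow> (\<And>y. y \<in> S \<Longrightarrow> \<bar>f y\<bar> \<le> 1) \<Longrightarrow>
      \<bar>measure_pmf.expectation (P h x) f - f x - h * (\<Sum>y\<in>F. q x y * (f y - f x))\<bar> \<le> \<epsilon> h"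
proof -
  define ex where "ex h = pmf (P h x) x - (1 - (\<Sum>y\<in>F. q x y) * h)" for h
  define e where "e y h = pmf (P h x) y - q x y * h" for y h
  \<comment> \<open>The factor 2 covers both the mass on \<open>x\<close> and its targets and the mass that escapes.\<close>
  define \<epsilon> where "\<epsilon> h = 2 * (\<bar>ex h\<bar> + (\<Sum>y\<in>F. \<bar>e y h\<bar>))" for h
  have xF: "x \<notin> F" using F by auto
  have qx: "(\<Sum>\<^sub>\<infinity>y\<in>S - {x}. q x y) = (\<Sum>y\<in>F. q x y)"
  proof -
    have "(\<Sum>\<^sub>\<infinity>y\<in>S - {x}. q x y) = (\<Sum>\<^sub>\<infinity>y\<in>F. q x y)"
      by (rule infsum_cong_neutral) (use F zero in auto)
    then show ?thesis using F by simp
  qed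
  have lim_ex: "((\<lambda>h. ex h / h) \<longlongrightarrow> 0) (at_right 0)"
    using rates x unfolding has_transition_rates_def qx[symmetric] ex_def
    by (intro smalloD_tendsto) (auto simp: qx)
  have lim_e: "((\<lambda>h. e y h / h) \<longlongrightarrow> 0) (at_right 0)" if "y \<in> F" for y
  proof -
    have "y \<in> S" "x \<noteq> y" using that F by auto
    then show ?thesis
      using rates x unfolding has_transition_rates_def e_def by (intro smalloD_tendsto) auto
  qed
  have "((\<lambda>h. 2 * (\<bar>ex h / h\<bar> + (\<Sum>y\<in>F. \<bar>e y h / h\<bar>))) \<longlongrightarrow> 2 * (\<bar>0\<bar> + (\<Sum>y\<in>F. \<bar>0\<bar>))) (at_right 0)"
    by (intro tendsto_intros lim_ex lim_e)
  also have "?this \<longleftrightarrow> ((\<lambda>h. \<epsilon> h / h) \<longlongrightarrow> 2 * (\<bar>0\<bar> + (\<Sum>y\<in>F. \<bar>0\<bar>))) (at_right 0)"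
    by (intro tendsto_cong eventually_at_rightI[of 0 1])
       (auto simp: \<epsilon>_def add_divide_distrib sum_divide_distrib[symmetric])
  finally have lim: "((\<lambda>h. \<epsilon> h / h) \<longlongrightarrow> 0) (at_right 0)" by simp
  have main: "\<bar>measure_pmf.expectation (P h x) f - f x - h * (\<Sum>y\<in>F. q x y * (f y - f x))\<bar> \<le> \<epsilon> h"
    if h: "0 \<le> h" and f: "\<And>y. y \<in> S \<Longrightarrow> \<bar>f y\<bar> \<le> 1" for f h
  proof -
    let ?M = "measure_pmf (P h x)" and ?I = "insert x F"
    have sub: "set_pmf (P h x) \<subseteq> S" using sg h x by (auto simp: transition_semigroup_def)
    have bnd: "AE y in ?M. \<bar>f y\<bar> \<le> 1" using sub f by (auto simp: AE_measure_pmf_iff)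
    have int: "integrable ?M f"
      by (rule measure_pmf.integrable_const_bound[where B=1]) (use bnd in auto)
    have int1: "integrable ?M (\<lambda>y. indicator A y * f y)" for A
      by (rule measure_pmf.integrable_const_bound[where B=1])
         (use bnd in \<open>auto simp: indicator_def\<close>)
    have "measure_pmf.expectation (P h x) f
        = measure_pmf.expectation (P h x) (\<lambda>y. indicator ?I y * f y + indicator (- ?I) y * f y)"
      by (intro Bochner_Integration.integral_cong) (auto simp: indicator_def)
    also have "\<dots> = measure_pmf.expectation (P h x) (\<lambda>y. indicator ?I y * f y) +
         measure_pmf.expectation (P h x) (\<lambda>y. indicator (- ?I) y * f y)" (is "_ = _ + ?R")
      by (intro Bochner_Integration.integral_add int1)
    also have "measure_pmf.expectation (P h x) (\<lambda>y. indicator ?I y * f y) = (\<Sum>y\<in>?I. f y * pmf (P h x) y)"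
      using F by (subst integral_measure_pmf_real[of ?I]) (auto simp: indicator_def split: if_splits)
    finally have E: "measure_pmf.expectation (P h x) f = f x * pmf (P h x) x + (\<Sum>y\<in>F. f y * pmf (P h x) y) + ?R"
      using F xF by simp
    have "\<bar>?R\<bar> \<le> measure_pmf.expectation (P h x) (\<lambda>y. indicator (- ?I) y)"
      by (rule integral_abs_bound[THEN order_trans], rule integral_mono_AE)
         (use int1 bnd in \<open>auto simp: indicator_def intro!: measure_pmf.integrable_const_bound[where B=1]\<close>)
    also have "\<dots> = 1 - measure_pmf.prob (P h x) ?I"
      using measure_pmf.prob_compl[of ?I "P h x"] by (simp add: Compl_eq_Diff_UNIV)
    also have "\<dots> = 1 - (pmf (P h x) x + (\<Sum>y\<in>F. pmf (P h x) y))"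
      using F xF by (simp add: measure_measure_pmf_finite)
    also have "\<dots> = - ex h - (\<Sum>y\<in>F. e y h)"
      by (simp add: ex_def e_def sum_subtractf sum_distrib_right)
    also have "\<dots> \<le> \<bar>ex h\<bar> + (\<Sum>y\<in>F. \<bar>e y h\<bar>)"
      using sum_abs[of "\<lambda>y. e y h" F] by linarith
    finally have R: "\<bar>?R\<bar> \<le> \<bar>ex h\<bar> + (\<Sum>y\<in>F. \<bar>e y h\<bar>)" .
    have "measure_pmf.expectation (P h x) f - f x - h * (\<Sum>y\<in>F. q x y * (f y - f x))
        = f x * ex h + (\<Sum>y\<in>F. f y * e y h) + ?R"
      unfolding E ex_def e_def
      by (simp add: algebra_simps sum.distrib sum_subtractf sum_distrib_left sum_distrib_right)
    moreover have "\<bar>f x * ex h\<bar> \<le> \<bar>ex h\<bar>"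
      using f[OF x] by (simp add: abs_mult mult_left_le_one_le)
    moreover have "\<bar>\<Sum>y\<in>F. f y * e y h\<bar> \<le> (\<Sum>y\<in>F. \<bar>e y h\<bar>)"
      using F f by (intro sum_abs[THEN order_trans] sum_mono)
        (auto simp: abs_mult intro!: mult_left_le_one_le)
    ultimately show ?thesis using R by (simp add: \<epsilon>_def)
  qed
  show ?thesis
    by (rule that[OF lim main])
qed

text \<open>
  Conditioning on the state after a short time uses the rates out of \<open>x\<close> and its finitely many
  targets only. The \<open>o(h)\<close> terms need not be uniform in the state, so the corresponding argument for
  the forward equation, where the short time comes last, is not available.
\<close>

lemma kolmogorov_backward:
  fixes q :: "'s \<Rightarrow> 's \<Rightarrow> real" and F :: "'s \<Rightarrow> 's set"
  assumes sg: "transition_semigroup S P" and rates: "has_transition_rates S q P"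
    and F: "\<And>x. x \<in> S \<Longrightarrow> finite (F x)" "\<And>x. x \<in> S \<Longrightarrow> F x \<subseteq> S - {x}"
    and zero: "\<And>x y. x \<in> S \<Longrightarrow> y \<in> S - {x} - F x \<Longrightarrow> q x y = 0"
    and x: "x \<in> S" and t: "t \<ge> 0"
  shows "((\<lambda>t. pmf (P t x) y) has_real_derivative
     (\<Sum>z\<in>F x. q x z * (pmf (P t z) y - pmf (P t x) y))) (at t within {0..})"
proof -
  define u where "u t x = pmf (P t x) y" for t x
  define G where "G t = (\<Sum>z\<in>F x. q x z * (u t z - u t x))" for t
  define expands where "expands z \<epsilon> \<longleftrightarrow> ((\<lambda>h. \<epsilon> h / h) \<longlongrightarrow> 0) (at_right 0) \<and>
      (\<forall>t h. 0 \<le> t \<longrightarrow> 0 \<le> h \<longrightarrow>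
        \<bar>u (h + t) z - u t z - h * (\<Sum>y\<in>F z. q z y * (u t y - u t z))\<bar> \<le> \<epsilon> h)"
    for z and \<epsilon> :: "real \<Rightarrow> real"
  have "\<exists>\<epsilon>. expands z \<epsilon>" if z: "z \<in> S" for z
  proof -
    obtain \<epsilon> where \<epsilon>: "((\<lambda>h. \<epsilon> h / h) \<longlongrightarrow> 0) (at_right 0)"
      "\<And>f h. 0 \<le> h \<Longrightarrow> (\<And>y. y \<in> S \<Longrightarrow> \<bar>f y\<bar> \<le> 1) \<Longrightarrow>
      \<bar>measure_pmf.expectation (P h z) f - f z - h * (\<Sum>y\<in>F z. q z y * (f y - f z))\<bar> \<le> \<epsilon> h"
      using transition_rates_expansion[OF sg rates z F(1,2)[OF z] zero[OF z]] by blast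
    have "u (h + t) z = measure_pmf.expectation (P h z) (u t)" if "0 \<le> h" "0 \<le> t" for h t
      using sg z that unfolding transition_semigroup_def u_def by (simp add: pmf_bind)
    then have "\<bar>u (h + t) z - u t z - h * (\<Sum>y\<in>F z. q z y * (u t y - u t z))\<bar> \<le> \<epsilon> h"
      if "0 \<le> t" "0 \<le> h" for t h
      using \<epsilon>(2)[of h "u t"] that by (simp add: u_def pmf_le_1)
    then show ?thesis using \<epsilon>(1) by (auto simp: expands_def)
  qed
  then obtain \<epsilon> where "\<And>z. z \<in> S \<Longrightarrow> expands z (\<epsilon> z)"
    using bchoice[of S expands] by blast
  then have \<epsilon>0: "\<And>z. z \<in> S \<Longrightarrow> ((\<lambda>h. \<epsilon> z h / h) \<longlongrightarrow> 0) (at_right 0)"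
      and \<epsilon>: "\<And>z t h. z \<in> S \<Longrightarrow> 0 \<le> t \<Longrightarrow> 0 \<le> h \<Longrightarrow>
        \<bar>u (h + t) z - u t z - h * (\<Sum>y\<in>F z. q z y * (u t y - u t z))\<bar> \<le> \<epsilon> z h"
    unfolding expands_def by blast+
  define \<eta> where "\<eta> z h = \<epsilon> z h + h * (\<Sum>y\<in>F z. \<bar>q z y\<bar>)" for z h
  \<comment> \<open>\<open>\<eta> z\<close> is a modulus of continuity of \<open>t \<mapsto> u t z\<close> that is uniform in \<open>t\<close>. The difference quotient
    between \<open>s\<close> and \<open>t\<close> is the generator at the earlier of the two times, up to \<open>\<epsilon>\<close>;
    for \<open>s < t\<close> the modulus moves the generator to time \<open>t\<close>.\<close>
  have \<eta>: "\<bar>u (h + t) z - u t z\<bar> \<le> \<eta> z h" if "z \<in> S" "0 \<le> t" "0 \<le> h" for z t h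
  proof -
    have "\<bar>\<Sum>y\<in>F z. q z y * (u t y - u t z)\<bar> \<le> (\<Sum>y\<in>F z. \<bar>q z y\<bar>)"
    proof (rule sum_abs[THEN order_trans], rule sum_mono)
      fix w
      have "\<bar>u t w - u t z\<bar> \<le> 1"
        using pmf_nonneg[of "P t w" y] pmf_nonneg[of "P t z" y] pmf_le_1[of "P t w" y] pmf_le_1[of "P t z" y]
        unfolding u_def by linarith
      then show "\<bar>q z w * (u t w - u t z)\<bar> \<le> \<bar>q z w\<bar>" by (simp add: abs_mult mult_left_le)
    qed
    then have "\<bar>h * (\<Sum>y\<in>F z. q z y * (u t y - u t z))\<bar> \<le> h * (\<Sum>y\<in>F z. \<bar>q z y\<bar>)"
      using that by (simp add: abs_mult mult_left_mono)
    then show ?thesis using \<epsilon>[OF that] unfolding \<eta>_def by linarith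
  qed
  have \<eta>0: "(\<eta> z \<longlongrightarrow> 0) (at_right 0)" if z: "z \<in> S" for z
  proof -
    have "((\<lambda>h. (\<epsilon> z h / h) * h + h * (\<Sum>y\<in>F z. \<bar>q z y\<bar>)) \<longlongrightarrow> 0 * 0 + 0 * (\<Sum>y\<in>F z. \<bar>q z y\<bar>)) (at_right 0)"
      by (intro tendsto_add tendsto_mult tendsto_const tendsto_ident_at \<epsilon>0 z)
    also have "?this \<longleftrightarrow> (\<eta> z \<longlongrightarrow> 0 * 0 + 0 * (\<Sum>y\<in>F z. \<bar>q z y\<bar>)) (at_right 0)"
      by (intro tendsto_cong eventually_at_rightI[of 0 1]) (auto simp: \<eta>_def)
    finally show ?thesis by simp
  qed
  define \<rho> where "\<rho> h = \<epsilon> x h / h + (\<Sum>z\<in>F x. \<bar>q x z\<bar> * (\<eta> z h + \<eta> x h))" for h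
  have FS: "z \<in> S" if "z \<in> F x" for z using F(2)[OF x] that by auto
  have "((\<lambda>h. \<epsilon> x h / h + (\<Sum>z\<in>F x. \<bar>q x z\<bar> * (\<eta> z h + \<eta> x h))) \<longlongrightarrow>
      0 + (\<Sum>z\<in>F x. \<bar>q x z\<bar> * (0 + 0))) (at_right 0)"
    by (intro tendsto_add tendsto_sum tendsto_mult tendsto_const \<epsilon>0 \<eta>0 x FS)
  moreover have "\<rho> = (\<lambda>h. \<epsilon> x h / h + (\<Sum>z\<in>F x. \<bar>q x z\<bar> * (\<eta> z h + \<eta> x h)))"
    by (simp add: fun_eq_iff \<rho>_def)
  ultimately have \<rho>0: "(\<rho> \<longlongrightarrow> 0) (at_right 0)" by simp
  have bound: "\<bar>(u s x - u t x) / (s - t) - G t\<bar> \<le> \<rho> \<bar>s - t\<bar>" if s: "s \<ge> 0" "s \<noteq> t" for s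
  proof -
    define r h where "r = min s t" and "h = \<bar>s - t\<bar>"
    have rh: "r \<ge> 0" "h > 0" using s t by (auto simp: r_def h_def)
    have max: "h + r = max s t" by (auto simp: r_def h_def)
    have 1: "\<bar>(u (h + r) x - u r x) / h - G r\<bar> \<le> \<epsilon> x h / h"
    proof -
      have "(u (h + r) x - u r x) / h - G r = (u (h + r) x - u r x - h * G r) / h"
        using rh(2) by (simp add: field_simps)
      then show ?thesis
        using \<epsilon>[OF x rh(1) less_imp_le[OF rh(2)]] rh(2) unfolding G_def
        by (simp add: divide_right_mono)
    qed
    have 2: "(u (h + r) x - u r x) / h = (u s x - u t x) / (s - t)"
      unfolding max using s by (cases "s \<le> t") (simp_all add: r_def h_def divide_simps, simp add: algebra_simps)
    have 3: "\<bar>u r z - u t z\<bar> \<le> \<eta> z h" if z: "z \<in> S" for z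
    proof (cases "s \<le> t")
      case True
      then show ?thesis
        using \<eta>[OF z rh(1) less_imp_le[OF rh(2)]] unfolding max by (simp add: r_def abs_minus_commute)
    next
      case False
      have "0 \<le> \<eta> z h" using \<eta>[OF z rh(1) less_imp_le[OF rh(2)]] by linarith
      then show ?thesis using False by (simp add: r_def)
    qed
    have "\<bar>G r - G t\<bar> = \<bar>\<Sum>z\<in>F x. q x z * ((u r z - u t z) - (u r x - u t x))\<bar>"
      unfolding G_def sum_subtractf[symmetric]
      by (intro arg_cong[where f=abs] sum.cong) (simp_all add: algebra_simps)
    also have "\<dots> \<le> (\<Sum>z\<in>F x. \<bar>q x z\<bar> * (\<eta> z h + \<eta> x h))"
    proof (rule sum_abs[THEN order_trans], rule sum_mono)
      fix z assume "z \<in> F x"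
      then have "\<bar>(u r z - u t z) - (u r x - u t x)\<bar> \<le> \<eta> z h + \<eta> x h"
        using 3[OF FS] 3[OF x] by (smt (verit))
      then show "\<bar>q x z * ((u r z - u t z) - (u r x - u t x))\<bar> \<le> \<bar>q x z\<bar> * (\<eta> z h + \<eta> x h)"
        by (simp add: abs_mult mult_left_mono)
    qed
    finally show ?thesis using 1 unfolding 2 \<rho>_def h_def[symmetric] by linarith
  qed
  have flt: "filterlim (\<lambda>s. \<bar>s - t\<bar>) (at_right 0) (at t within {0..})"
    unfolding filterlim_at
    by (auto simp: eventually_at_filter intro!: tendsto_eq_intros)
  have "((\<lambda>s. (u s x - u t x) / (s - t)) \<longlongrightarrow> G t) (at t within {0..})"
    unfolding Lim_null[of _ "G t"]
    by (rule Lim_null_comparison[OF _ filterlim_compose[OF \<rho>0 flt]])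
       (auto simp: eventually_at_filter bound)
  then show ?thesis unfolding has_field_derivative_iff u_def G_def .
qed

text \<open>
  A bound \<open>B * (2 * C * t) ^ n / fact n\<close> on the solution bounds its derivative, and integrating this
  bound gives the one for \<open>Suc n\<close>. For \<open>n \<rightarrow> \<infinity>\<close> the bounds tend to 0.
\<close>

lemma backward_equation_unique_zero:
  fixes q :: "'s \<Rightarrow> 's \<Rightarrow> real" and w :: "real \<Rightarrow> 's \<Rightarrow> real"
  assumes F: "\<And>x. x \<in> S \<Longrightarrow> F x \<subseteq> S"
    and q: "\<And>x y. x \<in> S \<Longrightarrow> 0 \<le> q x y" "\<And>x. x \<in> S \<Longrightarrow> (\<Sum>y\<in>F x. q x y) \<le> C"
    and der: "\<And>x t. x \<in> S \<Longrightarrow> t \<ge> 0 \<Longrightarrow> ((\<lambda>t. w t x) has_real_derivative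
        (\<Sum>z\<in>F x. q x z * (w t z - w t x))) (at t within {0..})"
    and init: "\<And>x. x \<in> S \<Longrightarrow> w 0 x = 0"
    and bnd: "\<And>x t. x \<in> S \<Longrightarrow> t \<ge> 0 \<Longrightarrow> \<bar>w t x\<bar> \<le> B"
    and x: "x \<in> S" and t: "t \<ge> 0"
  shows "w t x = 0"
proof -
  have B: "0 \<le> B" using bnd[OF x t] by linarith
  have C: "0 \<le> C" using q(1)[OF x] q(2)[OF x] by (meson order_trans sum_nonneg)
  have iter: "\<bar>w t x\<bar> \<le> B * (2 * C * t) ^ n / fact n" if "x \<in> S" "t \<ge> 0" for n x t
    using that
  proof (induction n arbitrary: x t)
    case 0
    then show ?case using bnd by simp
  next
    case (Suc n)
    define g where "g s = B * (2 * C * s) ^ Suc n / fact (Suc n)" for s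
    have dg: "(g has_real_derivative 2 * C * (B * (2 * C * s) ^ n / fact n)) (at s within A)" for s A
    proof -
      have "((\<lambda>s. B * (2 * C) ^ Suc n / fact (Suc n) * s ^ Suc n) has_real_derivative
          B * (2 * C) ^ Suc n / fact (Suc n) * (real (Suc n) * s ^ (Suc n - Suc 0))) (at s within A)"
        by (intro DERIV_cmult DERIV_pow)
      moreover have "B * (2 * C) ^ Suc n / fact (Suc n) * (real (Suc n) * s ^ (Suc n - Suc 0))
          = 2 * C * (B * (2 * C * s) ^ n / fact n)"
        unfolding fact_Suc by (simp add: power_mult_distrib del: of_nat_Suc)
      moreover have "(\<lambda>s. B * (2 * C) ^ Suc n / fact (Suc n) * s ^ Suc n) = g"
        by (simp add: g_def fun_eq_iff power_mult_distrib del: fact_Suc)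
      ultimately show ?thesis by (simp only:)
    qed
    have rate: "\<bar>\<Sum>z\<in>F x. q x z * (w s z - w s x)\<bar> \<le> 2 * C * (B * (2 * C * s) ^ n / fact n)"
      if s: "s \<ge> 0" for s
    proof -
      let ?b = "B * (2 * C * s) ^ n / fact n"
      have "\<bar>\<Sum>z\<in>F x. q x z * (w s z - w s x)\<bar> \<le> (\<Sum>z\<in>F x. q x z * (2 * ?b))"
      proof (rule sum_abs[THEN order_trans], rule sum_mono)
        fix z assume "z \<in> F x"
        then have "z \<in> S" using F[OF Suc.prems(1)] by blast
        then have "\<bar>w s z - w s x\<bar> \<le> 2 * ?b"
          using Suc.IH[of z s] Suc.IH[of x s] s Suc.prems(1) by linarith
        then have "q x z * \<bar>w s z - w s x\<bar> \<le> q x z * (2 * ?b)"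
          by (rule mult_left_mono) (rule q(1)[OF Suc.prems(1)])
        then show "\<bar>q x z * (w s z - w s x)\<bar> \<le> q x z * (2 * ?b)"
          using q(1)[OF Suc.prems(1)] by (simp only: abs_mult abs_of_nonneg)
      qed
      also have "\<dots> = (\<Sum>z\<in>F x. q x z) * (2 * ?b)" by (simp only: sum_distrib_right)
      also have "\<dots> \<le> C * (2 * ?b)"
        using q(2)[OF Suc.prems(1)] B C s by (intro mult_right_mono) auto
      finally show ?thesis by (simp add: mult_ac)
    qed
    have *: "((\<lambda>t. w t x) has_real_derivative
        (\<Sum>z\<in>F x. q x z * (w s z - w s x))) (at s within {0..t})" if "0 \<le> s" for s
      by (rule has_field_derivative_subset[OF der]) (use Suc.prems that in auto)
    \<comment> \<open>The bounds from above and below on \<open>w\<close> are the cases \<open>a = -1\<close> and \<open>a = 1\<close>.\<close>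
    have mono: "g 0 + a * w 0 x \<le> g t + a * w t x" if a: "a = 1 \<or> a = -1" for a :: real
    proof (rule DERIV_nonneg_imp_increasing_open[where f="\<lambda>t. g t + a * w t x"])
      have **: "((\<lambda>t. g t + a * w t x) has_real_derivative 2 * C * (B * (2 * C * s) ^ n / fact n)
        + a * (\<Sum>z\<in>F x. q x z * (w s z - w s x))) (at s within {0..t})" if "0 \<le> s" for s
        by (intro DERIV_add dg DERIV_cmult * that)
      show "continuous_on {0..t} (\<lambda>t. g t + a * w t x)"
        by (rule DERIV_continuous_on[OF **]) (simp only: atLeastAtMost_iff)
      fix s assume s: "0 < s" "s < t"
      have "at s within {0..t} = at s" using s by (simp add: at_within_Icc_at)
      moreover have "0 \<le> 2 * C * (B * (2 * C * s) ^ n / fact n)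
        + a * (\<Sum>z\<in>F x. q x z * (w s z - w s x))"
      proof -
        have "\<bar>a * (\<Sum>z\<in>F x. q x z * (w s z - w s x))\<bar> = \<bar>\<Sum>z\<in>F x. q x z * (w s z - w s x)\<bar>"
          using a by (elim disjE) (simp_all only: mult_1 mult_minus1 abs_minus_cancel)
        then show ?thesis using rate[OF less_imp_le[OF s(1)]] by linarith
      qed
      ultimately show "\<exists>y. ((\<lambda>t. g t + a * w t x) has_real_derivative y) (at s) \<and> 0 \<le> y"
        using **[OF less_imp_le[OF s(1)]] by (intro exI conjI) (simp only:)
    qed (use Suc.prems in simp_all)
    have "g 0 = 0" by (simp add: g_def)
    then have "\<bar>w t x\<bar> \<le> g t"
      using mono[of 1] mono[of "-1"] init[OF Suc.prems(1)] by linarith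
    then show ?case unfolding g_def .
  qed
  have "(\<lambda>n. (2 * C * t) ^ n /\<^sub>R fact n) \<longlonglongrightarrow> 0"
    by (rule summable_LIMSEQ_zero[OF summable_exp_generic])
  then have "(\<lambda>n. B * ((2 * C * t) ^ n / fact n)) \<longlonglongrightarrow> B * 0"
    by (intro tendsto_mult_left) (simp add: divide_inverse mult.commute)
  moreover have "\<bar>w t x\<bar> \<le> B * ((2 * C * t) ^ n / fact n)" for n
    using iter[OF x t, of n] by simp
  ultimately have "\<bar>w t x\<bar> \<le> B * 0"
    by (intro LIMSEQ_le_const[where X="\<lambda>n. B * ((2 * C * t) ^ n / fact n)"]) auto
  then show ?thesis by simp
qed

section \<open>First-passage paths of the phase walk\<close>

text \<open>
  Let \<open>m j\<close> be the number of arrivals of size \<open>j\<close> on a path of the free phase walk that ends \<open>h\<close>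
  phases below its start, where \<open>h \<ge> 1\<close>. The path has \<open>n\<close> arrivals and \<open>d\<close> services, and its last
  step is a service if it ends at its first visit to the end point. The weight of a path is the
  product of the rates of its steps. Then \<open>profile_weight\<close> is the total weight of the first-passage paths, a proportion
  \<open>h / (d + n)\<close> of all orderings, where the factor \<open>\<nu>\<close> of the last step is left out.
\<close>

definition profile_weight :: "nat \<Rightarrow> nat \<Rightarrow> real \<Rightarrow> (nat \<Rightarrow> real) \<Rightarrow> nat \<Rightarrow> (nat \<Rightarrow> nat) \<Rightarrow> real" where
  "profile_weight k l \<nu> lam h m =
     (let n = \<Sum>j=1..l. m j; d = h + k * (\<Sum>j=1..l. j * m j) in
       real h * fact (d + n - 1) * (\<Prod>j=1..l. lam j ^ m j / fact (m j)) * \<nu> ^ (d - 1) / fact d)"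

text \<open>
  The profiles of paths with \<open>N + 1\<close> steps: \<open>gamma0\<close> is the number \<open>d + n\<close> of steps.
\<close>

definition arrival_profiles :: "nat \<Rightarrow> nat \<Rightarrow> nat \<Rightarrow> nat \<Rightarrow> (nat \<Rightarrow> nat) set" where
  "arrival_profiles k l h N = {m \<in> {1..l} \<rightarrow>\<^sub>E UNIV. gamma0 k l h (\<Sum>j=1..l. m j) m = Suc N}"

lemma arrival_profiles_iff: "m \<in> arrival_profiles k l h N \<longleftrightarrow>
  m \<in> {1..l} \<rightarrow>\<^sub>E UNIV \<and> h + (\<Sum>j=1..l. (1 + k * j) * m j) = Suc N"
  by (auto simp: arrival_profiles_def gamma0_def sum.distrib sum_distrib_left algebra_simps)

lemma finite_arrival_profiles: "finite (arrival_profiles k l h N)"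
proof (rule finite_subset)
  show "arrival_profiles k l h N \<subseteq> {1..l} \<rightarrow>\<^sub>E {..Suc N}"
  proof
    fix m assume m: "m \<in> arrival_profiles k l h N"
    have "m j \<le> Suc N" if "j \<in> {1..l}" for j
    proof -
      have "m j \<le> (\<Sum>j=1..l. m j)" using that by (intro member_le_sum) auto
      also have "\<dots> \<le> Suc N" using m by (auto simp: arrival_profiles_def gamma0_def)
      finally show ?thesis .
    qed
    then show "m \<in> {1..l} \<rightarrow>\<^sub>E {..Suc N}" using m by (auto simp: arrival_profiles_def PiE_iff)
  qed
qed (auto intro: finite_PiE)

text \<open>
  Decompose by the first step: after a service \<open>h - 1\<close> phases of descent remain, and after an arrival
  of size \<open>j\<close> there remain \<open>h + k * j\<close>. Without the common factor \<open>K\<close>, the identity reads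
  \<open>(h - 1) * d + (\<Sum>j. (h + k * j) * m j) = h * (d + n - 1)\<close>, which holds since
  \<open>k * (\<Sum>j. j * m j) = d - h\<close>.
\<close>

lemma profile_weight_first_step:
  assumes h: "h \<ge> 1" and m: "m \<in> arrival_profiles k l h (Suc N)"
  shows "profile_weight k l \<nu> lam h m = \<nu> * profile_weight k l \<nu> lam (h - 1) m +
    (\<Sum>j=1..l. if m j = 0 then 0 else lam j * profile_weight k l \<nu> lam (h + k * j) (m(j := m j - 1)))"
proof -
  define n where "n = (\<Sum>j=1..l. m j)"
  define w where "w = (\<Sum>j=1..l. j * m j)"
  define d where "d = h + k * w"
  define p where "p = (\<Prod>j=1..l. lam j ^ m j / fact (m j))"
  define K where "K = fact N * p * \<nu> ^ (d - 1) / fact d"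
  have dn: "d + n = Suc (Suc N)" using m by (simp add: arrival_profiles_def gamma0_def d_def n_def w_def)
  have T0: "profile_weight k l \<nu> lam h m = real h * (Suc N) * K"
  proof -
    have "profile_weight k l \<nu> lam h m = real h * fact (d + n - 1) * p * \<nu> ^ (d - 1) / fact d"
      by (simp add: profile_weight_def Let_def n_def w_def d_def p_def)
    then show ?thesis by (simp add: dn K_def)
  qed
  have T1: "\<nu> * profile_weight k l \<nu> lam (h - 1) m = (real h - 1) * d * K"
  proof (cases "h = 1")
    \<comment> \<open>For \<open>h = 1\<close> both sides vanish. This includes \<open>d = 1\<close>, where \<open>d - 2\<close> would be truncated.\<close>
    case True
    then show ?thesis by (simp add: profile_weight_def Let_def)
  next
    case False
    then obtain d' where d': "d = Suc (Suc d')" using h by (cases d; cases "d - 1") (auto simp: d_def)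
    have e: "h - 1 + k * w = Suc d'" using d' h by (simp add: d_def)
    have e2: "Suc d' + n - 1 = N" using dn d' by simp
    have "profile_weight k l \<nu> lam (h - 1) m = real (h - 1) * fact (Suc d' + n - 1) * p * \<nu> ^ (Suc d' - 1) / fact (Suc d')"
      unfolding profile_weight_def Let_def n_def[symmetric] w_def[symmetric] e p_def[symmetric] ..
    moreover have "real (h - 1) = real h - 1" using h by simp
    moreover have "(fact (Suc (Suc d')) :: real) = real (Suc (Suc d')) * fact (Suc d')" by (rule fact_Suc)
    ultimately show ?thesis unfolding e2 K_def d' by (simp del: of_nat_Suc fact_Suc)
  qed
  have T2: "(if m j = 0 then 0 else lam j * profile_weight k l \<nu> lam (h + k * j) (m(j := m j - 1)))
      = (real h + k * j) * m j * K" if j: "j \<in> {1..l}" for j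
  proof (cases "m j")
    case (Suc r)
    define m' where "m' = m(j := r)"
    have up: "(\<Sum>i=1..l. f i (m i)) + f j r = (\<Sum>i=1..l. f i (m' i)) + f j (Suc r)"
      for f :: "nat \<Rightarrow> nat \<Rightarrow> nat"
    proof -
      have "(\<Sum>i\<in>{1..l} - {j}. f i (m i)) = (\<Sum>i\<in>{1..l} - {j}. f i (m' i))"
        by (intro sum.cong) (auto simp: m'_def)
      then show ?thesis
        using sum.remove[OF finite_atLeastAtMost j, of "\<lambda>i. f i (m i)"]
          sum.remove[OF finite_atLeastAtMost j, of "\<lambda>i. f i (m' i)"] Suc by (simp add: m'_def)
    qed
    have n': "n = Suc (\<Sum>i=1..l. m' i)"
      using up[of "\<lambda>_ x. x"] unfolding n_def by simp
    have w': "w = (\<Sum>i=1..l. i * m' i) + j"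
      using up[of "\<lambda>i x. i * x"] unfolding w_def by simp
    have d': "h + k * j + k * (\<Sum>i=1..l. i * m' i) = d"
      by (simp add: d_def w' algebra_simps)
    have e: "d + (\<Sum>i=1..l. m' i) - 1 = N" using dn n' by simp
    have p': "lam j * (\<Prod>i=1..l. lam i ^ m' i / fact (m' i)) = (Suc r) * p"
    proof -
      define R where "R = (\<Prod>i\<in>{1..l} - {j}. lam i ^ m i / fact (m i))"
      have "R = (\<Prod>i\<in>{1..l} - {j}. lam i ^ m' i / fact (m' i))"
        unfolding R_def by (intro prod.cong) (auto simp: m'_def)
      then have "(\<Prod>i=1..l. lam i ^ m' i / fact (m' i)) = lam j ^ r / fact r * R"
        using prod.remove[OF finite_atLeastAtMost j, of "\<lambda>i. lam i ^ m' i / fact (m' i)"]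
        by (simp add: m'_def)
      moreover have "p = lam j ^ Suc r / fact (Suc r) * R"
        using prod.remove[OF finite_atLeastAtMost j, of "\<lambda>i. lam i ^ m i / fact (m i)"]
        unfolding p_def R_def Suc .
      ultimately show ?thesis unfolding fact_Suc by (simp del: of_nat_Suc)
    qed
    have "lam j * profile_weight k l \<nu> lam (h + k * j) m' = real (h + k * j) * fact N *
        (lam j * (\<Prod>i=1..l. lam i ^ m' i / fact (m' i))) * \<nu> ^ (d - 1) / fact d"
      unfolding profile_weight_def Let_def d' e by simp
    also have "\<dots> = (real h + k * j) * m j * K"
      unfolding p' K_def Suc by simp
    finally show ?thesis using Suc by (simp add: m'_def)
  qed simp
  have "(\<Sum>j=1..l. (real h + k * j) * m j) = real h * n + (d - real h)"
    by (simp add: n_def d_def w_def sum.distrib sum_distrib_left algebra_simps)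
  then have T3: "(\<Sum>j=1..l. (real h + k * j) * m j * K) = (real h * n + (d - real h)) * K"
    by (simp only: sum_distrib_right[symmetric])
  have "real d + n = Suc (Suc N)" using dn by (metis of_nat_add)
  then have sn: "real (Suc N) = real d + n - 1" by simp
  have "(\<Sum>j=1..l. if m j = 0 then 0 else lam j * profile_weight k l \<nu> lam (h + k * j) (m(j := m j - 1)))
     = (real h * n + (d - real h)) * K"
    unfolding T3[symmetric] by (rule sum.cong[OF refl T2])
  then show ?thesis unfolding T0 T1 sn by (simp add: algebra_simps)
qed

text \<open>
  The weight of the paths of \<open>N + 1\<close> steps whose last step is the first to reach the level \<open>-h\<close>,
  without the rate of that step.
\<close>

definition first_passage_weight :: "nat \<Rightarrow> nat \<Rightarrow> real \<Rightarrow> (nat \<Rightarrow> real) \<Rightarrow> nat \<Rightarrow> nat \<Rightarrow> real" where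
  "first_passage_weight k l \<nu> lam N h = (\<Sum>m\<in>arrival_profiles k l h N. profile_weight k l \<nu> lam h m)"

lemma first_passage_weight_0: "first_passage_weight k l \<nu> lam N 0 = 0"
  by (simp add: first_passage_weight_def profile_weight_def Let_def)

lemma first_passage_weight_eq_0: "h > Suc N \<Longrightarrow> first_passage_weight k l \<nu> lam N h = 0"
proof -
  assume "h > Suc N"
  then have "arrival_profiles k l h N = {}" by (auto simp: arrival_profiles_def gamma0_def)
  then show ?thesis by (simp add: first_passage_weight_def)
qed

text \<open>
  An arrival of size \<open>j\<close> as first step corresponds to lowering \<open>m j\<close> by one.
\<close>

lemma first_passage_weight_Suc:
  assumes h: "h \<ge> 1"
  shows "first_passage_weight k l \<nu> lam (Suc N) h = \<nu> * first_passage_weight k l \<nu> lam N (h - 1) + (\<Sum>j=1..l. lam j * first_passage_weight k l \<nu> lam N (h + k * j))"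
proof -
  have G: "arrival_profiles k l h (Suc N) = arrival_profiles k l (h - 1) N"
    using h by (auto simp: arrival_profiles_iff)
  have *: "(\<Sum>m\<in>arrival_profiles k l h (Suc N). if m j = 0 then 0 else lam j * profile_weight k l \<nu> lam (h + k * j) (m(j := m j - 1)))
      = lam j * first_passage_weight k l \<nu> lam N (h + k * j)" if j: "j \<in> {1..l}" for j
  proof -
    have up: "(\<Sum>i=1..l. (1 + k * i) * (m(j := x)) i) + (1 + k * j) * m j
         = (\<Sum>i=1..l. (1 + k * i) * m i) + (1 + k * j) * x" for m :: "nat \<Rightarrow> nat" and x
    proof -
      have "(\<Sum>i\<in>{1..l} - {j}. (1 + k * i) * (m(j := x)) i) = (\<Sum>i\<in>{1..l} - {j}. (1 + k * i) * m i)"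
        by (intro sum.cong) auto
      then show ?thesis
        using sum.remove[OF finite_atLeastAtMost j, of "\<lambda>i. (1 + k * i) * m i"]
          sum.remove[OF finite_atLeastAtMost j, of "\<lambda>i. (1 + k * i) * (m(j := x)) i"] by simp
    qed
    have "(\<Sum>m\<in>arrival_profiles k l h (Suc N). if m j = 0 then 0 else lam j * profile_weight k l \<nu> lam (h + k * j) (m(j := m j - 1)))
      = (\<Sum>m\<in>{m\<in>arrival_profiles k l h (Suc N). m j \<noteq> 0}. lam j * profile_weight k l \<nu> lam (h + k * j) (m(j := m j - 1)))"
      by (intro sum.mono_neutral_cong_right finite_arrival_profiles) auto
    also have "\<dots> = (\<Sum>m\<in>arrival_profiles k l (h + k * j) N. lam j * profile_weight k l \<nu> lam (h + k * j) m)"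
    proof (rule sum.reindex_bij_witness[where i="\<lambda>m. m(j := Suc (m j))" and j="\<lambda>m. m(j := m j - 1)"])
      fix m assume m: "m \<in> {m \<in> arrival_profiles k l h (Suc N). m j \<noteq> 0}"
      then show "m(j := m j - 1) \<in> arrival_profiles k l (h + k * j) N"
        using j up[of m "m j - 1"] unfolding arrival_profiles_iff by (cases "m j") (auto simp: PiE_iff extensional_def)
    next
      fix m assume m: "m \<in> arrival_profiles k l (h + k * j) N"
      then show "m(j := Suc (m j)) \<in> {m \<in> arrival_profiles k l h (Suc N). m j \<noteq> 0}"
        using j up[of m "Suc (m j)"] unfolding arrival_profiles_iff by (auto simp: PiE_iff extensional_def)
    qed auto
    finally show ?thesis by (simp add: first_passage_weight_def sum_distrib_left)
  qed
  have "first_passage_weight k l \<nu> lam (Suc N) h = (\<Sum>m\<in>arrival_profiles k l h (Suc N). \<nu> * profile_weight k l \<nu> lam (h - 1) m +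
    (\<Sum>j=1..l. if m j = 0 then 0 else lam j * profile_weight k l \<nu> lam (h + k * j) (m(j := m j - 1))))"
    unfolding first_passage_weight_def by (intro sum.cong refl profile_weight_first_step h)
  also have "\<dots> = (\<Sum>m\<in>arrival_profiles k l h (Suc N). \<nu> * profile_weight k l \<nu> lam (h - 1) m) +
    (\<Sum>j=1..l. \<Sum>m\<in>arrival_profiles k l h (Suc N). if m j = 0 then 0 else lam j * profile_weight k l \<nu> lam (h + k * j) (m(j := m j - 1)))"
    by (simp only: sum.distrib sum.swap[of _ "{1..l}"])
  also have "\<dots> = \<nu> * first_passage_weight k l \<nu> lam N (h - 1) + (\<Sum>j=1..l. lam j * first_passage_weight k l \<nu> lam N (h + k * j))"
  proof -
    have "(\<Sum>m\<in>arrival_profiles k l h (Suc N). \<nu> * profile_weight k l \<nu> lam (h - 1) m) = \<nu> * first_passage_weight k l \<nu> lam N (h - 1)"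
      by (simp add: G sum_distrib_left first_passage_weight_def)
    moreover have "(\<Sum>j=1..l. \<Sum>m\<in>arrival_profiles k l h (Suc N).
        if m j = 0 then 0 else lam j * profile_weight k l \<nu> lam (h + k * j) (m(j := m j - 1)))
      = (\<Sum>j=1..l. lam j * first_passage_weight k l \<nu> lam N (h + k * j))"
      by (rule sum.cong[OF refl *])
    ultimately show ?thesis by (simp only:)
  qed
  finally show ?thesis .
qed

text \<open>
  The weight of the paths of \<open>N\<close> steps of the queue that start with \<open>i\<close> phases and end empty. A
  service in the empty state is a step without effect: this is the case \<open>0 - 1 = 0\<close> of the
  truncated subtraction.
\<close>

primrec idle_weight :: "nat \<Rightarrow> nat \<Rightarrow> real \<Rightarrow> (nat \<Rightarrow> real) \<Rightarrow> nat \<Rightarrow> nat \<Rightarrow> real" where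
  "idle_weight k l \<nu> lam 0 i = (if i = 0 then 1 else 0)"
| "idle_weight k l \<nu> lam (Suc N) i = \<nu> * idle_weight k l \<nu> lam N (i - 1) + (\<Sum>j=1..l. lam j * idle_weight k l \<nu> lam N (i + k * j))"

text \<open>
  If a path has \<open>f\<close> services in the empty state and ends empty, then the free walk with the same steps
  ends \<open>i + f\<close> below its start, at a minimum; one more service makes it a first passage to
  \<open>h = i + f + 1\<close> below. Formally both sides satisfy the same recursion. For \<open>i = 0\<close> the service
  term of the recursion on the right also has the index \<open>h = 0\<close>, which contributes nothing.
\<close>

lemma idle_weight_eq_sum_first_passage: "idle_weight k l \<nu> lam N i = (\<Sum>h\<in>{i<..Suc N}. first_passage_weight k l \<nu> lam N h)"
proof (induction N arbitrary: i)
  case 0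
  have "arrival_profiles k l (Suc 0) 0 = {\<lambda>x\<in>{1..l}. 0}"
  proof (intro equalityI subsetI)
    fix m assume "m \<in> arrival_profiles k l (Suc 0) 0"
    then have "m \<in> {1..l} \<rightarrow>\<^sub>E UNIV" "(\<Sum>j=1..l. (1 + k * j) * m j) = 0" by (auto simp: arrival_profiles_iff)
    then show "m \<in> {\<lambda>x\<in>{1..l}. 0}" by (auto simp: PiE_iff extensional_def restrict_def)
  qed (auto simp: arrival_profiles_iff)
  then have "first_passage_weight k l \<nu> lam 0 (Suc 0) = 1" by (simp add: first_passage_weight_def profile_weight_def Let_def)
  moreover have "{i<..Suc 0} = (if i = 0 then {Suc 0} else {})" by auto
  ultimately show ?case by simp
next
  case (Suc N)
  let ?b = "first_passage_weight k l \<nu> lam N"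
  have "(\<Sum>h\<in>{i<..Suc (Suc N)}. first_passage_weight k l \<nu> lam (Suc N) h)
      = (\<Sum>h\<in>{i<..Suc (Suc N)}. \<nu> * ?b (h - 1) + (\<Sum>j=1..l. lam j * ?b (h + k * j)))"
    by (intro sum.cong refl first_passage_weight_Suc) auto
  also have "\<dots> = \<nu> * (\<Sum>h\<in>{i<..Suc (Suc N)}. ?b (h - 1)) +
      (\<Sum>j=1..l. lam j * (\<Sum>h\<in>{i<..Suc (Suc N)}. ?b (h + k * j)))"
    by (simp only: sum.distrib sum_distrib_left sum.swap[of _ "{1..l}"])
  also have "(\<Sum>h\<in>{i<..Suc (Suc N)}. ?b (h - 1)) = (\<Sum>h\<in>{i..Suc N}. ?b h)"
    by (rule sum.reindex_bij_witness[where i=Suc and j="\<lambda>h. h - 1"]) auto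
  also have "\<dots> = (\<Sum>h\<in>{i - 1<..Suc N}. ?b h)"
  proof (cases i)
    case 0
    then show ?thesis by (intro sum.mono_neutral_right) (auto simp: first_passage_weight_0 not_less)
  next
    case (Suc j)
    then have "{i..Suc N} = {i - 1<..Suc N}" by auto
    then show ?thesis by simp
  qed
  also have "(\<lambda>j. lam j * (\<Sum>h\<in>{i<..Suc (Suc N)}. ?b (h + k * j))) = (\<lambda>j. lam j * (\<Sum>h\<in>{i + k * j<..Suc N}. ?b h))"
  proof
    fix j
    have "(\<Sum>h\<in>{i<..Suc (Suc N)}. ?b (h + k * j)) = (\<Sum>h\<in>{i + k * j<..Suc (Suc N) + k * j}. ?b h)"
      by (rule sum.reindex_bij_witness[where i="\<lambda>h. h - k * j" and j="\<lambda>h. h + k * j"]) auto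
    also have "\<dots> = (\<Sum>h\<in>{i + k * j<..Suc N}. ?b h)"
      by (intro sum.mono_neutral_right) (auto simp: first_passage_weight_eq_0 not_le)
    finally show "lam j * (\<Sum>h\<in>{i<..Suc (Suc N)}. ?b (h + k * j)) = lam j * (\<Sum>h\<in>{i + k * j<..Suc N}. ?b h)"
      by simp
  qed
  finally show ?case by (simp add: Suc.IH)
qed

lemma coeff0_eq_profile_weight:
  assumes "(\<Sum>i=1..l. m i) = n" "h \<ge> 1" and L: "(\<Sum>i=1..l. lam i) \<noteq> 0"
  shows "coeff0 k l \<mu> lam h n m = profile_weight k l (real k * \<mu>) lam h m"
proof -
  define L where "L = (\<Sum>i=1..l. lam i)"
  have "L ^ n * (\<Prod>i=1..l. (lam i / L) ^ m i / fact (m i)) = (\<Prod>i=1..l. L ^ m i * ((lam i / L) ^ m i / fact (m i)))"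
    by (simp only: prod.distrib power_sum assms(1)[symmetric])
  also have "\<dots> = (\<Prod>i=1..l. lam i ^ m i / fact (m i))"
    using L by (intro prod.cong) (auto simp: L_def power_divide)
  finally have e: "L ^ n * (\<Prod>i=1..l. (lam i / L) ^ m i / fact (m i)) = (\<Prod>i=1..l. lam i ^ m i / fact (m i))" .
  have g: "gamma0 k l h n m - n = h + k * (\<Sum>j=1..l. j * m j)"
    by (simp add: gamma0_def)
  have "coeff0 k l \<mu> lam h n m = real h * (L ^ n * (\<Prod>i=1..l. (lam i / L) ^ m i / fact (m i))) *
       ((real k * \<mu>) ^ (gamma0 k l h n m - n - 1) / fact (gamma0 k l h n m - n)) * fact (gamma0 k l h n m - 1)"
    by (simp add: coeff0_def Let_def L_def)
  then show ?thesis unfolding e g unfolding gamma0_def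
    by (simp add: profile_weight_def Let_def assms(1)[symmetric] add_ac mult_ac)
qed

section \<open>The probability that the Erlang queue is empty\<close>

lemma idle_weight_nonneg:
  assumes "0 \<le> \<nu>" "\<And>j. j \<in> {1..l} \<Longrightarrow> 0 \<le> lam j"
  shows "0 \<le> idle_weight k l \<nu> lam N i"
  using assms by (induction N arbitrary: i) (auto intro!: add_nonneg_nonneg mult_nonneg_nonneg sum_nonneg)

lemma idle_weight_le:
  assumes "0 \<le> \<nu>" "\<And>j. j \<in> {1..l} \<Longrightarrow> 0 \<le> lam j"
  shows "idle_weight k l \<nu> lam N i \<le> (\<nu> + (\<Sum>j=1..l. lam j)) ^ N"
proof (induction N arbitrary: i)
  case (Suc N)
  let ?c = "\<nu> + (\<Sum>j=1..l. lam j)"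
  have "idle_weight k l \<nu> lam (Suc N) i \<le> \<nu> * ?c ^ N + (\<Sum>j=1..l. lam j * ?c ^ N)"
    unfolding idle_weight.simps by (intro add_mono sum_mono mult_left_mono Suc.IH assms)
  also have "\<dots> = ?c ^ Suc N" by (simp add: sum_distrib_right[symmetric] distrib_right)
  finally show ?case .
qed auto

definition idle_series :: "nat \<Rightarrow> nat \<Rightarrow> real \<Rightarrow> (nat \<Rightarrow> real) \<Rightarrow> nat \<Rightarrow> real \<Rightarrow> real" where
  "idle_series k l \<nu> lam i t = (\<Sum>N. idle_weight k l \<nu> lam N i / fact N * t ^ N)"

context
  fixes k l :: nat and \<nu> :: real and lam :: "nat \<Rightarrow> real"
  assumes \<nu>: "0 \<le> \<nu>" and lam: "\<And>j. j \<in> {1..l} \<Longrightarrow> 0 \<le> lam j"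
begin

lemma summable_idle_series: "summable (\<lambda>N. idle_weight k l \<nu> lam N i / fact N * t ^ N)"
proof (rule summable_comparison_test')
  let ?c = "\<nu> + (\<Sum>j=1..l. lam j)"
  show "summable (\<lambda>N. (?c * \<bar>t\<bar>) ^ N /\<^sub>R fact N)" by (rule summable_exp_generic)
  fix N
  have "idle_weight k l \<nu> lam N i * \<bar>t\<bar> ^ N \<le> ?c ^ N * \<bar>t\<bar> ^ N"
    by (intro mult_right_mono idle_weight_le \<nu> lam) auto
  then show "norm (idle_weight k l \<nu> lam N i / fact N * t ^ N) \<le> (?c * \<bar>t\<bar>) ^ N /\<^sub>R fact N"
    using idle_weight_nonneg[OF \<nu> lam, where k=k and N=N and i=i]
    by (simp add: abs_mult power_abs power_mult_distrib divide_simps)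
qed

text \<open>
  Differentiation shifts the coefficients of an exponential generating function, so the recursion of
  the weights turns into a differential equation.
\<close>

lemma idle_series_has_derivative:
  "(idle_series k l \<nu> lam i has_real_derivative
     \<nu> * idle_series k l \<nu> lam (i - 1) t + (\<Sum>j=1..l. lam j * idle_series k l \<nu> lam (i + k * j) t)) (at t)"
proof -
  let ?s = "\<lambda>i N. idle_weight k l \<nu> lam N i / fact N"
  have "((\<lambda>t. \<Sum>N. ?s i N * t ^ N) has_real_derivative (\<Sum>N. diffs (?s i) N * t ^ N)) (at t)"
    by (rule termdiffs_strong_converges_everywhere) (rule summable_idle_series)
  moreover have "(\<Sum>N. diffs (?s i) N * t ^ N) =
      (\<Sum>N. \<nu> * (?s (i - 1) N * t ^ N) + (\<Sum>j=1..l. lam j * (?s (i + k * j) N * t ^ N)))"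
  proof (rule suminf_cong)
    fix N
    have "diffs (?s i) N = idle_weight k l \<nu> lam (Suc N) i / fact N"
      unfolding diffs_def fact_Suc by (simp del: of_nat_Suc idle_weight.simps)
    then show "diffs (?s i) N * t ^ N = \<nu> * (?s (i - 1) N * t ^ N) + (\<Sum>j=1..l. lam j * (?s (i + k * j) N * t ^ N))"
      by (simp add: add_divide_distrib sum_divide_distrib sum_distrib_right distrib_right mult.assoc)
  qed
  moreover have "\<dots> = \<nu> * idle_series k l \<nu> lam (i - 1) t + (\<Sum>j=1..l. lam j * idle_series k l \<nu> lam (i + k * j) t)"
    unfolding idle_series_def
    by (rule sums_unique[symmetric], intro sums_add sums_mult sums_sum summable_sums summable_idle_series)
  moreover have "idle_series k l \<nu> lam i = (\<lambda>t. \<Sum>N. ?s i N * t ^ N)"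
    by (simp add: fun_eq_iff idle_series_def)
  ultimately show ?thesis by simp
qed

lemma idle_series_0: "idle_series k l \<nu> lam i 0 = (if i = 0 then 1 else 0)"
  using powser_zero[of "\<lambda>N. idle_weight k l \<nu> lam N i / fact N"] by (simp add: idle_series_def)

lemma idle_series_bounds:
  assumes "0 \<le> t"
  shows "0 \<le> idle_series k l \<nu> lam i t" "idle_series k l \<nu> lam i t \<le> exp ((\<nu> + (\<Sum>j=1..l. lam j)) * t)"
proof -
  let ?c = "\<nu> + (\<Sum>j=1..l. lam j)"
  show "0 \<le> idle_series k l \<nu> lam i t"
    unfolding idle_series_def using assms by (intro suminf_nonneg summable_idle_series mult_nonneg_nonneg divide_nonneg_pos idle_weight_nonneg \<nu> lam) auto
  have "(\<Sum>N. idle_weight k l \<nu> lam N i / fact N * t ^ N) \<le> (\<Sum>N. (?c * t) ^ N /\<^sub>R fact N)"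
  proof (rule suminf_le[OF _ summable_idle_series summable_exp_generic])
    fix N
    have "idle_weight k l \<nu> lam N i * t ^ N \<le> ?c ^ N * t ^ N"
      using assms by (intro mult_right_mono idle_weight_le \<nu> lam) auto
    then show "idle_weight k l \<nu> lam N i / fact N * t ^ N \<le> (?c * t) ^ N /\<^sub>R fact N"
      by (simp add: power_mult_distrib divide_simps)
  qed
  then show "idle_series k l \<nu> lam i t \<le> exp (?c * t)" by (simp add: idle_series_def exp_def)
qed

end

definition erlang_targets :: "nat \<Rightarrow> nat \<Rightarrow> nat \<times> nat \<Rightarrow> (nat \<times> nat) set" where
  "erlang_targets k l x = (\<lambda>j. arrival k j x) ` {1..l} \<union> (if x = (0, 0) then {} else {service k x})"

lemma erlang_targets_subset:
  assumes "k \<ge> 1" "x \<in> erlang_states k"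
  shows "erlang_targets k l x \<subseteq> erlang_states k - {x}"
  using assms by (cases x) (auto simp: erlang_targets_def erlang_states_def)

lemma sum_erlang_rate:
  "(\<Sum>z\<in>erlang_targets k l x. erlang_rate k l \<mu> lam x z * g z) =
     (\<Sum>j=1..l. lam j * g (arrival k j x)) + (if x = (0, 0) then 0 else real k * \<mu> * g (service k x))"
proof -
  have fin: "finite (erlang_targets k l x)" by (simp add: erlang_targets_def)
  have "(\<Sum>z\<in>erlang_targets k l x. erlang_rate k l \<mu> lam x z * g z) =
      (\<Sum>z\<in>erlang_targets k l x. \<Sum>j=1..l. (if z = arrival k j x then lam j * g z else 0)) +
      (\<Sum>z\<in>erlang_targets k l x. if z = service k x then (if x = (0, 0) then 0 else real k * \<mu> * g z) else 0)"
    unfolding sum.distrib[symmetric]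
    by (intro sum.cong) (auto simp: erlang_rate_def distrib_right sum_distrib_right if_distrib[of "\<lambda>u. u * _"] cong: if_cong)
  also have "(\<Sum>z\<in>erlang_targets k l x. \<Sum>j=1..l. (if z = arrival k j x then lam j * g z else 0)) =
      (\<Sum>j=1..l. \<Sum>z\<in>erlang_targets k l x. (if z = arrival k j x then lam j * g z else 0))"
    by (rule sum.swap)
  also have "\<dots> = (\<Sum>j=1..l. lam j * g (arrival k j x))"
    using fin by (intro sum.cong refl) (auto simp: sum.delta erlang_targets_def)
  also have "(\<Sum>z\<in>erlang_targets k l x. if z = service k x then (if x = (0, 0) then 0 else real k * \<mu> * g z) else 0)
      = (if x = (0, 0) then 0 else real k * \<mu> * g (service k x))"
    using fin by (auto simp: sum.delta erlang_targets_def)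
  finally show ?thesis .
qed

lemma erlang_rate_eq_0: "y \<notin> erlang_targets k l x \<Longrightarrow> erlang_rate k l \<mu> lam x y = 0"
  by (auto simp: erlang_rate_def erlang_targets_def intro!: sum.neutral)

definition phases :: "nat \<Rightarrow> nat \<times> nat \<Rightarrow> nat" where
  "phases k x = (if fst x = 0 then 0 else k * (fst x - 1) + snd x)"

lemma phases_arrival:
  assumes "j \<ge> 1"
  shows "phases k (arrival k j x) = phases k x + k * j"
proof (cases x)
  case (Pair n s)
  then show ?thesis using assms by (cases n; cases j) (auto simp: phases_def algebra_simps)
qed

lemma phases_service:
  assumes "x \<in> erlang_states k" "x \<noteq> (0, 0)"
  shows "phases k (service k x) = phases k x - 1"
proof (cases x)
  case (Pair n s)
  then have "1 \<le> n" "1 \<le> s" "s \<le> k" using assms by (auto simp: erlang_states_def)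
  moreover then obtain m where "n = Suc m" by (cases n) auto
  ultimately show ?thesis using Pair by (cases m) (auto simp: phases_def)
qed

lemma phases_eq_0:
  assumes "x \<in> erlang_states k"
  shows "phases k x = 0 \<longleftrightarrow> x = (0, 0)"
  using assms by (auto simp: phases_def erlang_states_def)

text \<open>
  With the factor \<open>exp (- c * t)\<close>, the generating functions become a solution of the backward equations with
  values between 0 and 1 and with the correct initial values, so uniqueness applies.
\<close>

lemma erlang_idle_probability:
  assumes k: "k \<ge> 1" and \<mu>: "\<mu> > 0" and lam: "\<And>j. j \<in> {1..l} \<Longrightarrow> 0 < lam j"
    and sg: "transition_semigroup (erlang_states k) P"
    and rates: "has_transition_rates (erlang_states k) (erlang_rate k l \<mu> lam) P"
    and t: "t \<ge> 0"
  shows "pmf (P t (0, 0)) (0, 0) =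
    exp (- ((\<Sum>j=1..l. lam j) + real k * \<mu>) * t) * idle_series k l (real k * \<mu>) lam 0 t"
proof -
  define \<nu> where "\<nu> = real k * \<mu>"
  define c where "c = (\<Sum>j=1..l. lam j) + \<nu>"
  define q where "q = erlang_rate k l \<mu> lam"
  define v where "v t x = exp (- c * t) * idle_series k l \<nu> lam (phases k x) t" for t x
  define u where "u t x = pmf (P t x) (0, 0)" for t x
  have \<nu>: "0 \<le> \<nu>" using \<mu> by (simp add: \<nu>_def)
  have lam': "\<And>j. j \<in> {1..l} \<Longrightarrow> 0 \<le> lam j" using lam by (simp add: less_imp_le)
  have diff: "(\<Sum>z\<in>erlang_targets k l x. q x z * (g z - g x)) = (\<Sum>j=1..l. lam j * (g (arrival k j x) - g x))
      + (if x = (0, 0) then 0 else \<nu> * (g (service k x) - g x))" for g and x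
    unfolding q_def \<nu>_def by (rule sum_erlang_rate)
  have dv: "((\<lambda>t. v t x) has_real_derivative (\<Sum>z\<in>erlang_targets k l x. q x z * (v t z - v t x))) (at t within A)"
    if x: "x \<in> erlang_states k" for t x A
  proof -
    let ?i = "phases k x"
    let ?U = "idle_series k l \<nu> lam"
    have "((\<lambda>t. v t x) has_real_derivative
       exp (- c * t) * (- c) * ?U ?i t + exp (- c * t) * (\<nu> * ?U (?i - 1) t + (\<Sum>j=1..l. lam j * ?U (?i + k * j) t)))
       (at t within A)"
      unfolding v_def
      by (rule derivative_eq_intros DERIV_subset[OF idle_series_has_derivative[OF \<nu> lam']] refl subset_UNIV | assumption)+
         (simp add: algebra_simps)
    moreover have "exp (- c * t) * (- c) * ?U ?i t + exp (- c * t) * (\<nu> * ?U (?i - 1) t + (\<Sum>j=1..l. lam j * ?U (?i + k * j) t))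
        = (\<Sum>z\<in>erlang_targets k l x. q x z * (v t z - v t x))"
    proof -
      have "(\<Sum>j=1..l. lam j * (v t (arrival k j x) - v t x)) =
          (\<Sum>j=1..l. exp (- c * t) * (lam j * ?U (?i + k * j) t) - lam j * (exp (- c * t) * ?U ?i t))"
        by (intro sum.cong) (auto simp: v_def phases_arrival algebra_simps)
      also have "\<dots> = exp (- c * t) * (\<Sum>j=1..l. lam j * ?U (?i + k * j) t) - (c - \<nu>) * (exp (- c * t) * ?U ?i t)"
        by (simp add: sum_subtractf sum_distrib_left sum_distrib_right c_def)
      finally have 1: "(\<Sum>j=1..l. lam j * (v t (arrival k j x) - v t x)) = \<dots>" .
      have 2: "(if x = (0, 0) then 0 else \<nu> * (v t (service k x) - v t x))
          = \<nu> * (exp (- c * t) * ?U (?i - 1) t - exp (- c * t) * ?U ?i t)"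
        using phases_service[OF x] phases_eq_0[OF x] by (auto simp: v_def)
      show ?thesis unfolding diff 1 2 by (simp add: algebra_simps)
    qed
    ultimately show ?thesis by simp
  qed
  have "u t x - v t x = 0" if x: "x \<in> erlang_states k" for x
  proof (rule backward_equation_unique_zero[where S="erlang_states k" and F="erlang_targets k l" and q=q and C=c
        and B=1 and w="\<lambda>t x. u t x - v t x", OF _ _ _ _ _ _ x t])
    fix x assume x: "x \<in> erlang_states k"
    show "erlang_targets k l x \<subseteq> erlang_states k" using erlang_targets_subset[OF k x] by blast
    show "0 \<le> q x y" for y
      unfolding q_def erlang_rate_def using lam' \<mu> by (intro add_nonneg_nonneg sum_nonneg) auto
    show "(\<Sum>y\<in>erlang_targets k l x. q x y) \<le> c"
      using sum_erlang_rate[of k l \<mu> lam x "\<lambda>_. 1"] \<nu> by (simp add: q_def c_def \<nu>_def)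
    have "u 0 x = (if x = (0, 0) then 1 else 0)"
      using sg x by (auto simp: u_def transition_semigroup_def)
    moreover have "v 0 x = (if x = (0, 0) then 1 else 0)"
      unfolding v_def using phases_eq_0[OF x] by (simp only: idle_series_0[OF \<nu> lam']) simp
    ultimately show "u 0 x - v 0 x = 0" by simp
    fix t :: real assume t: "t \<ge> 0"
    have "0 \<le> v t x"
      unfolding v_def using idle_series_bounds(1)[OF \<nu> lam' t] by simp
    moreover have "v t x \<le> exp (- c * t) * exp (c * t)"
      unfolding v_def using idle_series_bounds(2)[OF \<nu> lam' t, where k=k and i="phases k x"]
      by (intro mult_left_mono) (auto simp: c_def add.commute)
    moreover have "exp (- c * t) * exp (c * t) = 1" by (simp add: exp_minus_inverse mult_exp_exp)
    moreover have "0 \<le> u t x" "u t x \<le> 1" by (auto simp: u_def pmf_le_1)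
    ultimately show "\<bar>u t x - v t x\<bar> \<le> 1" by linarith
    have "((\<lambda>t. u t x) has_real_derivative (\<Sum>z\<in>erlang_targets k l x. q x z * (u t z - u t x))) (at t within {0..})"
      unfolding u_def q_def
    proof (rule kolmogorov_backward[OF sg rates _ _ _ x t])
      show "finite (erlang_targets k l x)" for x by (simp add: erlang_targets_def)
      show "erlang_targets k l x \<subseteq> erlang_states k - {x}" if "x \<in> erlang_states k" for x
        using that by (rule erlang_targets_subset[OF k])
      show "erlang_rate k l \<mu> lam x y = 0" if "y \<in> erlang_states k - {x} - erlang_targets k l x" for x y
        using that by (intro erlang_rate_eq_0) blast
    qed
    from DERIV_diff[OF this dv[OF x]]
    show "((\<lambda>t. u t x - v t x) has_real_derivative
         (\<Sum>z\<in>erlang_targets k l x. q x z * ((u t z - v t z) - (u t x - v t x)))) (at t within {0..})"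
      unfolding sum_subtractf[symmetric] by (simp add: algebra_simps)
  qed
  then have "u t (0, 0) = v t (0, 0)" by (simp add: erlang_states_def)
  then show ?thesis by (simp add: u_def v_def c_def \<nu>_def phases_def)
qed

section \<open>Laws determined by transforms and tails, and Gamma integrals\<close>

text \<open>
  The characteristic function of a bounded random variable is a power series in the moments.
\<close>

lemma distr_eq_of_moments_eq:
  fixes U :: "'v \<Rightarrow> real" and V :: "'w \<Rightarrow> real"
  assumes "prob_space M" "prob_space N"
    and U[measurable]: "U \<in> borel_measurable M" and V[measurable]: "V \<in> borel_measurable N"
    and bU: "AE x in M. \<bar>U x\<bar> \<le> 1" and bV: "AE x in N. \<bar>V x\<bar> \<le> 1"
    and eq: "\<And>n. (\<integral>x. U x ^ n \<partial>M) = (\<integral>x. V x ^ n \<partial>N)"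
  shows "distr M borel U = distr N borel V"
proof -
  interpret M: prob_space M by fact
  interpret N: prob_space N by fact
  have char: "(\<lambda>n. (\<i> * t) ^ n /\<^sub>R fact n * of_real (\<integral>x. W x ^ n \<partial>K)) sums char (distr K borel W) t"
    if "prob_space K" and W[measurable]: "W \<in> borel_measurable K" and b: "AE x in K. \<bar>W x\<bar> \<le> 1"
    for K :: "'c measure" and W :: "'c \<Rightarrow> real" and t :: real
  proof -
    interpret K: prob_space K by fact
    let ?f = "\<lambda>n x. (\<i> * t) ^ n /\<^sub>R fact n * complex_of_real (W x ^ n)"
    have int: "integrable K (\<lambda>x. W x ^ n)" for n
      by (rule K.integrable_const_bound[where B=1], use b in eventually_elim)
         (auto simp: power_abs intro!: power_le_one)
    have "(\<lambda>n. integral\<^sup>L K (?f n)) sums (\<integral>x. (\<Sum>n. ?f n x) \<partial>K)"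
    proof (rule sums_integral)
      show "integrable K (?f n)" for n using int[of n] by (intro integrable_mult_right integrable_of_real)
      have f: "?f n x = (\<i> * t * W x) ^ n /\<^sub>R fact n" for n x by (simp add: power_mult_distrib)
      show "AE x in K. summable (\<lambda>n. norm (?f n x))"
        unfolding f by (intro AE_I2 summable_norm_exp)
      have "norm (\<integral>x. norm (?f n x) \<partial>K) \<le> \<bar>t\<bar> ^ n /\<^sub>R fact n" for n
      proof -
        have "(\<integral>x. norm (?f n x) \<partial>K) \<le> (\<integral>x. \<bar>t\<bar> ^ n /\<^sub>R fact n \<partial>K)"
        proof (rule integral_mono_AE)
          show "integrable K (\<lambda>x. norm (?f n x))"
            using int[of n] by (intro integrable_norm integrable_mult_right integrable_of_real)
          show "AE x in K. norm (?f n x) \<le> \<bar>t\<bar> ^ n /\<^sub>R fact n"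
            using b by eventually_elim
              (auto simp: norm_mult norm_power power_abs intro!: mult_left_le power_le_one)
        qed auto
        moreover have "0 \<le> (\<integral>x. norm (?f n x) \<partial>K)" by (intro integral_nonneg_AE AE_I2 norm_ge_zero)
        ultimately show ?thesis by (simp only: real_norm_def abs_of_nonneg lebesgue_integral_const K.prob_space) simp
      qed
      then show "summable (\<lambda>n. \<integral>x. norm (?f n x) \<partial>K)"
        by (intro summable_comparison_test'[OF summable_exp_generic])
    qed
    moreover have "integral\<^sup>L K (?f n) = (\<i> * t) ^ n /\<^sub>R fact n * of_real (\<integral>x. W x ^ n \<partial>K)" for n
      by (simp only: integral_mult_right_zero integral_complex_of_real)
    moreover have "(\<integral>x. (\<Sum>n. ?f n x) \<partial>K) = char (distr K borel W) t"
    proof -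
      have "(\<Sum>n. ?f n x) = iexp (t * W x)" for x
        by (simp add: exp_def power_mult_distrib mult_ac)
      then show ?thesis by (simp add: char_def integral_distr)
    qed
    ultimately show ?thesis by (simp only:)
  qed
  have "char (distr M borel U) t = char (distr N borel V) t" for t
    using char[OF \<open>prob_space M\<close> U bU, of t] char[OF \<open>prob_space N\<close> V bV, of t] unfolding eq
    by (rule sums_unique2)
  then show ?thesis
    by (intro Levy_uniqueness) (auto intro!: M.real_distribution_distr N.real_distribution_distr)
qed

text \<open>
  The moments of \<open>exp (- X)\<close>, which is bounded, are values of the Laplace transform of \<open>X\<close>.
\<close>

lemma prob_le_eq_of_laplace_eq:
  fixes X Y :: "'w \<Rightarrow> real"
  assumes "prob_space M"
    and X[measurable]: "X \<in> borel_measurable M" and Y[measurable]: "Y \<in> borel_measurable M"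
    and nX: "AE \<omega> in M. 0 \<le> X \<omega>" and nY: "AE \<omega> in M. 0 \<le> Y \<omega>"
    and eq: "\<And>z. z > 0 \<Longrightarrow> (\<integral>\<omega>. exp (- z * X \<omega>) \<partial>M) = (\<integral>\<omega>. exp (- z * Y \<omega>) \<partial>M)"
  shows "\<P>(\<omega> in M. X \<omega> \<le> x) = \<P>(\<omega> in M. Y \<omega> \<le> x)"
proof -
  interpret prob_space M by fact
  have "(\<integral>\<omega>. exp (- X \<omega>) ^ n \<partial>M) = (\<integral>\<omega>. exp (- Y \<omega>) ^ n \<partial>M)" for n
    using eq[of "real n"] by (cases "n = 0") (simp_all flip: exp_of_nat_mult)
  then have "distr M borel (\<lambda>\<omega>. exp (- X \<omega>)) = distr M borel (\<lambda>\<omega>. exp (- Y \<omega>))"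
    using nX nY by (intro distr_eq_of_moments_eq assms(1)) auto
  then have "measure (distr M borel (\<lambda>\<omega>. exp (- X \<omega>))) {exp (- x)..} =
      measure (distr M borel (\<lambda>\<omega>. exp (- Y \<omega>))) {exp (- x)..}" by simp
  then show ?thesis by (simp add: measure_distr vimage_def Int_def conj_commute)
qed

text \<open>
  The probabilities of \<open>X > s\<close> and \<open>X \<ge> s\<close> differ for at most countably many \<open>s\<close>, so each of them
  determines the law. The comparison in this form suits a first hitting time, whose strict and weak
  tails enclose the distribution function of the underlying process.
\<close>

lemma distr_eq_of_tails:
  fixes X :: "'v \<Rightarrow> real" and Y :: "'w \<Rightarrow> real"
  assumes "prob_space M" "prob_space N"
    and X[measurable]: "X \<in> borel_measurable M" and Y[measurable]: "Y \<in> borel_measurable N"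
    and nX: "AE \<omega> in M. 0 \<le> X \<omega>" and nY: "AE \<omega> in N. 0 \<le> Y \<omega>"
    and XY: "\<And>s. s > 0 \<Longrightarrow> \<P>(\<omega> in M. X \<omega> > s) \<le> \<P>(\<omega> in N. Y \<omega> \<ge> s)"
    and YX: "\<And>s. s > 0 \<Longrightarrow> \<P>(\<omega> in N. Y \<omega> > s) \<le> \<P>(\<omega> in M. X \<omega> \<ge> s)"
  shows "distr M borel X = distr N borel Y"
proof -
  \<comment> \<open>Both inequalities are needed, so the comparison of strict tails is proved for general spaces.\<close>
  have tail: "\<P>(\<omega> in K. X \<omega> > s) \<le> \<P>(\<omega> in L. Y \<omega> > s)"
    if "prob_space K" "prob_space L" and [measurable]: "X \<in> borel_measurable K" "Y \<in> borel_measurable L"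
      and le: "\<And>s. s > 0 \<Longrightarrow> \<P>(\<omega> in K. X \<omega> > s) \<le> \<P>(\<omega> in L. Y \<omega> \<ge> s)" and s: "s \<ge> 0"
    for K :: "'c measure" and L :: "'d measure" and X Y and s :: real
  proof -
    interpret K: prob_space K by fact
    interpret L: prob_space L by fact
    define A where "A n = {\<omega>\<in>space K. X \<omega> > s + 1 / real (Suc n)}" for n
    have "(\<lambda>n. K.prob (A n)) \<longlonglongrightarrow> K.prob (\<Union>n. A n)"
    proof (rule K.finite_Lim_measure_incseq)
      show "incseq A"
      proof (rule incseq_SucI)
        fix n
        have "1 / real (Suc (Suc n)) \<le> 1 / real (Suc n)" by (simp add: divide_simps)
        then show "A n \<subseteq> A (Suc n)" by (auto simp: A_def)
      qed
    qed (auto simp: A_def)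
    also have "(\<Union>n. A n) = {\<omega>\<in>space K. X \<omega> > s}"
    proof (intro equalityI subsetI)
      fix \<omega> assume "\<omega> \<in> {\<omega>\<in>space K. X \<omega> > s}"
      then obtain n where "1 / real (Suc n) < X \<omega> - s" "\<omega> \<in> space K"
        using reals_Archimedean[of "X \<omega> - s"] by (auto simp: inverse_eq_divide)
      then show "\<omega> \<in> (\<Union>n. A n)" by (auto simp: A_def intro!: exI[of _ n])
    next
      fix \<omega> assume "\<omega> \<in> (\<Union>n. A n)"
      then obtain n where "\<omega> \<in> space K" "s + 1 / real (Suc n) < X \<omega>" by (auto simp: A_def)
      moreover have "1 / real (Suc n) > 0" by simp
      ultimately show "\<omega> \<in> {\<omega>\<in>space K. X \<omega> > s}" by (simp del: of_nat_Suc, linarith)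
    qed
    finally have lim: "(\<lambda>n. K.prob (A n)) \<longlonglongrightarrow> \<P>(\<omega> in K. X \<omega> > s)" .
    have "K.prob (A n) \<le> \<P>(\<omega> in L. Y \<omega> > s)" for n
    proof -
      have p: "1 / real (Suc n) > 0" by simp
      have "K.prob (A n) \<le> \<P>(\<omega> in L. Y \<omega> \<ge> s + 1 / real (Suc n))"
        unfolding A_def using s p by (intro le) linarith
      also have "\<dots> \<le> \<P>(\<omega> in L. Y \<omega> > s)"
      proof (rule L.finite_measure_mono)
        show "{\<omega> \<in> space L. s + 1 / real (Suc n) \<le> Y \<omega>} \<subseteq> {\<omega> \<in> space L. s < Y \<omega>}"
          using p by (smt (verit) Collect_mono)
      qed simp
      finally show ?thesis .
    qed
    then show ?thesis by (intro LIMSEQ_le_const2[OF lim]) auto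
  qed
  interpret M: prob_space M by fact
  interpret N: prob_space N by fact
  have "cdf (distr M borel X) s = cdf (distr N borel Y) s" for s
  proof -
    have 1: "cdf (distr M borel X) s = 1 - \<P>(\<omega> in M. X \<omega> > s)"
    proof -
      have "\<P>(\<omega> in M. \<not> X \<omega> > s) = 1 - \<P>(\<omega> in M. X \<omega> > s)" by (rule M.prob_neg) measurable
      then show ?thesis
        unfolding cdf_def by (subst measure_distr) (auto simp: not_less vimage_def Int_def conj_commute)
    qed
    have 2: "cdf (distr N borel Y) s = 1 - \<P>(\<omega> in N. Y \<omega> > s)"
    proof -
      have "\<P>(\<omega> in N. \<not> Y \<omega> > s) = 1 - \<P>(\<omega> in N. Y \<omega> > s)" by (rule N.prob_neg) measurable
      then show ?thesis
        unfolding cdf_def by (subst measure_distr) (auto simp: not_less vimage_def Int_def conj_commute)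
    qed
    have "\<P>(\<omega> in M. X \<omega> > s) = \<P>(\<omega> in N. Y \<omega> > s)"
    proof (cases "s \<ge> 0")
      case True
      then show ?thesis using tail[OF assms(1,2) X Y XY True] tail[OF assms(2,1) Y X YX True] by simp
    next
      case False
      have "\<P>(\<omega> in M. X \<omega> > s) = 1" using nX False by (subst M.prob_Collect_eq_1) auto
      moreover have "\<P>(\<omega> in N. Y \<omega> > s) = 1" using nY False by (subst N.prob_Collect_eq_1) auto
      ultimately show ?thesis by simp
    qed
    then show ?thesis unfolding 1 2 by simp
  qed
  then show ?thesis
    by (intro cdf_unique) (auto intro!: M.real_distribution_distr N.real_distribution_distr)
qed

text \<open>
  Read from right to left, this represents a negative power by exponentials, whose expectations are
  Laplace transforms.
\<close>

lemma nn_integral_powr_exp_scaled: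
  assumes a: "a > 0" and d: "d > 0"
  shows "(\<integral>\<^sup>+z. ennreal (indicator {0<..} z * z powr (a - 1) * exp (- z * d)) \<partial>lborel) = ennreal (Gamma a * d powr (- a))"
proof -
  let ?f = "\<lambda>z. ennreal (indicator {0<..} z * z powr (a - 1) * exp (- z * d))"
  have "(\<integral>\<^sup>+z. ?f z \<partial>lborel) = ennreal \<bar>1 / d\<bar> * (\<integral>\<^sup>+z. ?f (0 + 1 / d * z) \<partial>lborel)"
    by (rule nn_integral_real_affine) (use d in auto)
  also have "(\<integral>\<^sup>+z. ?f (0 + 1 / d * z) \<partial>lborel) =
      (\<integral>\<^sup>+z. ennreal (d powr (1 - a)) * ennreal (indicator {0..} z * z powr (a - 1) / exp z) \<partial>lborel)"
  proof (rule nn_integral_cong_AE)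
    have "AE z in lborel. z \<noteq> (0::real)" by (rule AE_lborel_singleton)
    then show "AE z in lborel. ?f (0 + 1 / d * z) = ennreal (d powr (1 - a)) * ennreal (indicator {0..} z * z powr (a - 1) / exp z)"
    proof eventually_elim
      case (elim z)
      show ?case
      proof (cases "z > 0")
        case True
        have "d powr (1 - a) = 1 / d powr (a - 1)"
          using powr_minus_divide[of d "a - 1"] by simp
        then have "(1 / d * z) powr (a - 1) = d powr (1 - a) * z powr (a - 1)"
          using True d by (simp add: powr_divide)
        then show ?thesis using True d
          by (simp add: ennreal_mult'[symmetric] exp_minus divide_inverse mult_ac)
      qed (use elim d in \<open>auto simp: indicator_def zero_less_mult_iff not_less zero_less_divide_iff\<close>)
    qed
  qed
  also have "\<dots> = ennreal (d powr (1 - a)) * ennreal (Gamma a)"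
    by (subst nn_integral_cmult) (auto simp: Gamma_conv_nn_integral_real[OF a])
  also have "ennreal \<bar>1 / d\<bar> * (ennreal (d powr (1 - a)) * ennreal (Gamma a)) = ennreal (Gamma a * d powr (- a))"
    using d a by (simp add: ennreal_mult'[symmetric] powr_diff powr_minus field_simps)
  finally show ?thesis .
qed

text \<open>
  Substitute \<open>u = z powr \<alpha>\<close> in Euler's integral.
\<close>

lemma nn_integral_powr_exp_powr:
  assumes \<alpha>: "\<alpha> > 0" and p: "p > 0"
  shows "(\<integral>\<^sup>+z. ennreal (indicator {0<..} z * z powr (\<alpha> * p - 1) * exp (- (z powr \<alpha>))) \<partial>lborel) = ennreal (Gamma p / \<alpha>)"
proof -
  let ?f = "\<lambda>u. u powr (p - 1) / exp u" and ?g = "\<lambda>z. z powr \<alpha>" and ?g' = "\<lambda>z. \<alpha> * z powr (\<alpha> - 1)"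
  have img: "?g ` {0<..} = {0<..}"
  proof (intro equalityI subsetI)
    fix u :: real assume "u \<in> {0<..}"
    then show "u \<in> ?g ` {0<..}"
      using \<alpha> by (intro image_eqI[of _ _ "u powr (1 / \<alpha>)"]) (auto simp: powr_powr)
  qed auto
  have f: "(?f has_integral Gamma p) {0<..}"
  proof -
    have "(?f has_integral Gamma p) {0<..} \<longleftrightarrow> (?f has_integral Gamma p) {0..}"
      by (rule has_integral_spike_set_eq; rule negligible_subset[of "{0}"]; auto)
    then show ?thesis using Gamma_integral_real[OF p] by simp
  qed
  have "?f absolutely_integrable_on {0<..}"
    using f by (intro nonnegative_absolutely_integrable_1) auto
  moreover have "integral {0<..} ?f = Gamma p" using f by (rule integral_unique)
  ultimately have "(\<lambda>z. \<bar>?g' z\<bar> * ?f (?g z)) absolutely_integrable_on {0<..} \<and>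
      integral {0<..} (\<lambda>z. \<bar>?g' z\<bar> * ?f (?g z)) = Gamma p"
  proof (subst has_absolute_integral_change_of_variables_1'[of "{0<..}" ?g ?g' ?f "Gamma p"], goal_cases)
    case (2 x)
    then show ?case by (intro DERIV_subset[OF has_real_derivative_powr]) auto
  next
    case 3
    show ?case
    proof (rule inj_onI)
      fix x y :: real assume xy: "x \<in> {0<..}" "y \<in> {0<..}" "x powr \<alpha> = y powr \<alpha>"
      have "x = (x powr \<alpha>) powr (1 / \<alpha>)" using xy(1,2) \<alpha> by (simp add: powr_powr)
      also have "\<dots> = y" unfolding xy(3) using xy(1,2) \<alpha> by (simp add: powr_powr)
      finally show "x = y" .
    qed
  qed (simp_all add: img)
  then have "((\<lambda>z. \<bar>?g' z\<bar> * ?f (?g z)) has_integral Gamma p) {0<..}"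
    by (metis set_lebesgue_integral_eq_integral(1) integrable_integral)
  then have "((\<lambda>z. 1 / \<alpha> * (\<bar>?g' z\<bar> * ?f (?g z))) has_integral 1 / \<alpha> * Gamma p) {0<..}"
    by (rule has_integral_mult_right)
  then have "integral\<^sup>N lborel (\<lambda>z. indicator {0<..} z * (1 / \<alpha> * (\<bar>?g' z\<bar> * ?f (?g z)))) = 1 / \<alpha> * Gamma p"
    by (rule nn_integral_has_integral_lebesgue[rotated]) (use \<alpha> in auto)
  also have "(\<lambda>z. ennreal (indicator {0<..} z * (1 / \<alpha> * (\<bar>?g' z\<bar> * ?f (?g z))))) =
      (\<lambda>z. ennreal (indicator {0<..} z * z powr (\<alpha> * p - 1) * exp (- (z powr \<alpha>))))"
    using \<alpha> by (auto simp: fun_eq_iff indicator_def powr_powr exp_minus divide_inverse powr_add[symmetric] algebra_simps)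
  finally show ?thesis by simp
qed

text \<open>
  Only \<open>[T, T + 1]\<close> is kept from Euler's integral. Since \<open>T\<close> is arbitrary, \<open>Gamma (\<alpha> * n + 1)\<close> with
  \<open>\<alpha> > 0\<close> grows faster in \<open>n\<close> than any geometric sequence.
\<close>

lemma Gamma_lower_bound:
  assumes x: "x \<ge> 0" and T: "T \<ge> (0::real)"
  shows "T powr x * exp (- (T + 1)) \<le> Gamma (x + 1)"
proof -
  have "ennreal (T powr x * exp (- (T + 1))) = (\<integral>\<^sup>+t. ennreal (T powr x * exp (- (T + 1))) * indicator {T..T+1} t \<partial>lborel)"
    by (simp add: nn_integral_cmult)
  also have "\<dots> \<le> (\<integral>\<^sup>+t. ennreal (indicator {0..} t * t powr (x + 1 - 1) / exp t) \<partial>lborel)"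
  proof (rule nn_integral_mono)
    fix t
    have "T powr x * exp (- (T + 1)) \<le> t powr x * exp (- t)" if "T \<le> t" "t \<le> T + 1"
      using that x T by (intro mult_mono powr_mono2) auto
    then show "ennreal (T powr x * exp (- (T + 1))) * indicator {T..T+1} t \<le> ennreal (indicator {0..} t * t powr (x + 1 - 1) / exp t)"
      using T by (auto simp: indicator_def exp_minus divide_inverse intro!: ennreal_leI)
  qed
  also have "\<dots> = ennreal (Gamma (x + 1))"
    using x by (subst Gamma_conv_nn_integral_real) auto
  finally show ?thesis using x by (simp add: ennreal_le_iff Gamma_real_nonneg)
qed

section \<open>First hitting times of a stable subordinator\<close>

context
  fixes M :: "'w measure" and D :: "real \<Rightarrow> 'w \<Rightarrow> real" and \<alpha> :: real
  assumes M: "prob_space M" and D: "stable_subordinator M \<alpha> D" and \<alpha>: "0 < \<alpha>"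
begin

interpretation prob_space M by (rule M)

lemma stable_measurable: "s \<ge> 0 \<Longrightarrow> D s \<in> borel_measurable M"
  using D by (auto simp: stable_subordinator_def levy_process_def)

lemma stable_laplace: "s \<ge> 0 \<Longrightarrow> z > 0 \<Longrightarrow> (\<integral>\<omega>. exp (- z * D s \<omega>) \<partial>M) = exp (- s * z powr \<alpha>)"
  using D by (auto simp: stable_subordinator_def)

lemma stable_mono: "AE \<omega> in M. mono_on {0..} (\<lambda>t. D t \<omega>)"
  using D by (auto simp: stable_subordinator_def)

lemma stable_integrable_exp:
  assumes "s \<ge> 0" "z > 0"
  shows "integrable M (\<lambda>\<omega>. exp (- z * D s \<omega>))"
  using stable_laplace[OF assms] not_integrable_integral_eq by fastforce

lemma stable_nonneg:
  assumes "s \<ge> 0"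
  shows "AE \<omega> in M. 0 \<le> D s \<omega>"
proof -
  have "AE \<omega> in M. D 0 \<omega> = 0" using D by (auto simp: stable_subordinator_def levy_process_def)
  then show ?thesis using stable_mono
    by eventually_elim (use assms in \<open>metis atLeast_iff mono_onD order_refl\<close>)
qed

text \<open>
  Markov's inequality for \<open>exp (- z * D s)\<close>. Large \<open>z\<close> show that \<open>D s\<close> is positive for \<open>s > 0\<close>, and
  large \<open>s\<close> that the paths are unbounded.
\<close>

lemma stable_markov_inequality:
  assumes s: "s \<ge> 0" and z: "z > 0"
  shows "\<P>(\<omega> in M. D s \<omega> \<le> t) \<le> exp (z * t - s * z powr \<alpha>)"
proof -
  note [measurable] = stable_measurable[OF s]
  have "\<P>(\<omega> in M. D s \<omega> \<le> t) = (\<integral>\<omega>. indicator {\<omega>\<in>space M. D s \<omega> \<le> t} \<omega> \<partial>M)" by simp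
  also have "\<dots> \<le> (\<integral>\<omega>. exp (z * t) * exp (- z * D s \<omega>) \<partial>M)"
  proof (rule integral_mono)
    show "integrable M (\<lambda>\<omega>. exp (z * t) * exp (- z * D s \<omega>))"
      by (rule integrable_mult_right[OF stable_integrable_exp[OF s z]])
    fix \<omega>
    show "indicator {\<omega>\<in>space M. D s \<omega> \<le> t} \<omega> \<le> exp (z * t) * exp (- z * D s \<omega>)"
      using z by (auto simp: indicator_def mult_exp_exp)
  qed (auto simp: integrable_indicator_iff emeasure_eq_measure)
  also have "\<dots> = exp (z * t) * exp (- s * z powr \<alpha>)" by (simp only: integral_mult_right_zero stable_laplace[OF s z])
  also have "\<dots> = exp (z * t - s * z powr \<alpha>)" by (simp add: mult_exp_exp)
  finally show ?thesis .
qed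

lemma stable_pos:
  assumes s: "s > 0"
  shows "AE \<omega> in M. 0 < D s \<omega>"
proof -
  note [measurable] = stable_measurable[OF less_imp_le[OF s]]
  have "((\<lambda>z. exp (- s * z powr \<alpha>)) \<longlongrightarrow> 0) at_top"
    using s \<alpha> by real_asymp
  moreover have "eventually (\<lambda>z. \<P>(\<omega> in M. D s \<omega> \<le> 0) \<le> exp (- s * z powr \<alpha>)) at_top"
    using eventually_gt_at_top[of 0] by eventually_elim (use stable_markov_inequality[of s _ 0] s in auto)
  ultimately have "\<P>(\<omega> in M. D s \<omega> \<le> 0) \<le> 0"
    by (intro tendsto_lowerbound[where f="\<lambda>z. exp (- s * z powr \<alpha>)"]) auto
  then have "\<P>(\<omega> in M. D s \<omega> \<le> 0) = 0" by (simp add: measure_le_0_iff)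
  then have "AE \<omega> in M. \<not> D s \<omega> \<le> 0" by (subst (asm) prob_Collect_eq_0) auto
  then show ?thesis by (simp add: not_le)
qed

lemma stable_unbounded: "AE \<omega> in M. \<exists>n::nat. D (real n) \<omega> > t"
proof -
  note [measurable] = stable_measurable[OF of_nat_0_le_iff]
  have "\<P>(\<omega> in M. \<forall>n::nat. D (real n) \<omega> \<le> t) \<le> exp (t - real n)" for n
  proof -
    have "\<P>(\<omega> in M. \<forall>n::nat. D (real n) \<omega> \<le> t) \<le> \<P>(\<omega> in M. D (real n) \<omega> \<le> t)"
      by (intro finite_measure_mono) auto
    also have "\<dots> \<le> exp (t - real n)" using stable_markov_inequality[of "real n" 1 t] by simp
    finally show ?thesis .
  qed
  moreover have "(\<lambda>n. exp (t - real n)) \<longlonglongrightarrow> 0" by real_asymp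
  ultimately have "\<P>(\<omega> in M. \<forall>n::nat. D (real n) \<omega> \<le> t) \<le> 0"
    by (intro LIMSEQ_le_const) auto
  then have "\<P>(\<omega> in M. \<forall>n::nat. D (real n) \<omega> \<le> t) = 0" by (simp add: measure_le_0_iff)
  then have "AE \<omega> in M. \<not> (\<forall>n::nat. D (real n) \<omega> \<le> t)" by (subst (asm) prob_Collect_eq_0) auto
  then show ?thesis by (simp add: not_le)
qed

text \<open>
  Write the negative power as an integral of exponentials. By Tonelli's theorem the expectation may
  be taken inside, where it is the Laplace transform \<open>exp (- z powr \<alpha>)\<close>.
\<close>

lemma stable_inverse_moment:
  "(\<integral>\<^sup>+\<omega>. ennreal ((D 1 \<omega> powr (- \<alpha>)) ^ m) \<partial>M) = ennreal (fact m / Gamma (\<alpha> * real m + 1))"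
proof (cases "m = 0")
  case True
  then show ?thesis by (simp add: emeasure_space_1)
next
  case False
  define a where "a = \<alpha> * real m"
  have a: "a > 0" using \<alpha> False by (simp add: a_def)
  note [measurable] = stable_measurable[of 1, simplified]
  interpret P: pair_sigma_finite M lborel ..
  let ?f = "\<lambda>z. indicator {0<..} z * z powr (a - 1) :: real"
  have "ennreal (Gamma a) * (\<integral>\<^sup>+\<omega>. ennreal ((D 1 \<omega> powr (- \<alpha>)) ^ m) \<partial>M)
      = (\<integral>\<^sup>+\<omega>. ennreal (Gamma a) * ennreal ((D 1 \<omega> powr (- \<alpha>)) ^ m) \<partial>M)"
    by (rule nn_integral_cmult[symmetric]) measurable
  also have "\<dots> = (\<integral>\<^sup>+\<omega>. \<integral>\<^sup>+z. ennreal (?f z * exp (- z * D 1 \<omega>)) \<partial>lborel \<partial>M)"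
  proof (rule nn_integral_cong_AE)
    show "AE \<omega> in M. ennreal (Gamma a) * ennreal ((D 1 \<omega> powr (- \<alpha>)) ^ m) =
        (\<integral>\<^sup>+z. ennreal (?f z * exp (- z * D 1 \<omega>)) \<partial>lborel)"
      using stable_pos[of 1, simplified]
    proof eventually_elim
      case (elim \<omega>)
      have "(D 1 \<omega> powr (- \<alpha>)) ^ m = D 1 \<omega> powr (- a)"
        using elim by (simp add: a_def powr_realpow[symmetric] powr_powr)
      then show ?case
        using nn_integral_powr_exp_scaled[OF a elim] a by (simp add: ennreal_mult')
    qed
  qed
  also have "\<dots> = (\<integral>\<^sup>+z. \<integral>\<^sup>+\<omega>. ennreal (?f z * exp (- z * D 1 \<omega>)) \<partial>M \<partial>lborel)"
    by (rule P.Fubini'[symmetric, of "\<lambda>\<omega> z. ennreal (?f z * exp (- z * D 1 \<omega>))"]) measurable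
  also have "\<dots> = (\<integral>\<^sup>+z. ennreal (indicator {0<..} z * z powr (\<alpha> * real m - 1) * exp (- (z powr \<alpha>))) \<partial>lborel)"
  proof (rule nn_integral_cong)
    fix z :: real
    show "(\<integral>\<^sup>+\<omega>. ennreal (?f z * exp (- z * D 1 \<omega>)) \<partial>M) =
        ennreal (indicator {0<..} z * z powr (\<alpha> * real m - 1) * exp (- (z powr \<alpha>)))"
    proof (cases "z > 0")
      case True
      then have "integrable M (\<lambda>\<omega>. ?f z * exp (- z * D 1 \<omega>))"
        by (intro integrable_mult_right stable_integrable_exp) auto
      then have "(\<integral>\<^sup>+\<omega>. ennreal (?f z * exp (- z * D 1 \<omega>)) \<partial>M) = ennreal (\<integral>\<omega>. ?f z * exp (- z * D 1 \<omega>) \<partial>M)"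
        by (rule nn_integral_eq_integral) auto
      also have "(\<integral>\<omega>. ?f z * exp (- z * D 1 \<omega>) \<partial>M) = ?f z * exp (- (z powr \<alpha>))"
        using stable_laplace[of 1 z] True by simp
      finally show ?thesis by (simp add: a_def)
    qed simp
  qed
  also have "\<dots> = ennreal (Gamma (real m) / \<alpha>)"
    using False by (intro nn_integral_powr_exp_powr \<alpha>) auto
  also have "Gamma (real m) / \<alpha> = Gamma a * (fact m / Gamma (\<alpha> * real m + 1))"
  proof -
    obtain n where n: "m = Suc n" using False by (cases m) auto
    have "Gamma (a + 1) = a * Gamma a" using a by (intro Gamma_plus1) (auto elim: nonpos_Ints_cases)
    moreover have "Gamma (real m) = fact n" unfolding n Gamma_fact[symmetric] by (simp add: add.commute)
    moreover have "Gamma a > 0" using a by (rule Gamma_real_pos)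
    ultimately have "Gamma a * (fact m / Gamma (a + 1)) = fact m / a" "Gamma (real m) = fact n" by auto
    moreover have "fact m / a = fact n / \<alpha>"
      unfolding a_def n fact_Suc using \<alpha> by (simp del: of_nat_Suc)
    ultimately show ?thesis by (simp add: a_def)
  qed
  finally have eq: "ennreal (Gamma a) * (\<integral>\<^sup>+\<omega>. ennreal ((D 1 \<omega> powr (- \<alpha>)) ^ m) \<partial>M) =
      ennreal (Gamma a) * ennreal (fact m / Gamma (\<alpha> * real m + 1))"
    by (simp only: ennreal_mult'[OF less_imp_le[OF Gamma_real_pos[OF a]]])
  have "ennreal (Gamma a) \<noteq> 0" "ennreal (Gamma a) \<noteq> top" using Gamma_real_pos[OF a] by auto
  then show ?thesis using eq by (simp add: ennreal_mult_cancel_left)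
qed

text \<open>
  Self-similarity: \<open>D s\<close> and \<open>s powr (1 / \<alpha>) * D 1\<close> have the same Laplace transform.
\<close>

lemma prob_stable_le:
  assumes s: "s > 0" and t: "t \<ge> 0"
  shows "\<P>(\<omega> in M. D s \<omega> \<le> t) = \<P>(\<omega> in M. s \<le> t powr \<alpha> * D 1 \<omega> powr (- \<alpha>))"
proof -
  note [measurable] = stable_measurable[of 1, simplified] stable_measurable[OF less_imp_le[OF s]]
  have "\<P>(\<omega> in M. D s \<omega> \<le> t) = \<P>(\<omega> in M. s powr (1 / \<alpha>) * D 1 \<omega> \<le> t)"
  proof (rule prob_le_eq_of_laplace_eq[OF M])
    show "AE \<omega> in M. 0 \<le> D s \<omega>" using s by (intro stable_nonneg) auto
    show "AE \<omega> in M. 0 \<le> s powr (1 / \<alpha>) * D 1 \<omega>" using stable_nonneg[of 1, simplified] by eventually_elim simp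
    fix z :: real assume z: "z > 0"
    have "(z * s powr (1 / \<alpha>)) powr \<alpha> = s * z powr \<alpha>"
      using z s \<alpha> by (simp add: powr_mult powr_powr)
    then show "(\<integral>\<omega>. exp (- z * D s \<omega>) \<partial>M) = (\<integral>\<omega>. exp (- z * (s powr (1 / \<alpha>) * D 1 \<omega>)) \<partial>M)"
      using stable_laplace[of s z] stable_laplace[of 1 "z * s powr (1 / \<alpha>)"] s z
      by (simp add: mult.assoc)
  qed measurable
  also have "\<dots> = \<P>(\<omega> in M. s \<le> t powr \<alpha> * D 1 \<omega> powr (- \<alpha>))"
  proof (rule finite_measure_eq_AE)
    show "AE \<omega> in M. \<omega> \<in> {\<omega> \<in> space M. s powr (1 / \<alpha>) * D 1 \<omega> \<le> t} \<longleftrightarrow>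
        \<omega> \<in> {\<omega> \<in> space M. s \<le> t powr \<alpha> * D 1 \<omega> powr (- \<alpha>)}"
      using stable_pos[of 1, simplified]
    proof eventually_elim
      case (elim \<omega>)
      define d where "d = D 1 \<omega>"
      have d: "d > 0" using elim by (simp add: d_def)
      have "s powr (1 / \<alpha>) * d \<le> t \<longleftrightarrow> (s powr (1 / \<alpha>) * d) powr \<alpha> \<le> t powr \<alpha>"
        using \<alpha> d t s by (smt (verit) powr_less_mono2 powr_mono2 mult_nonneg_nonneg powr_ge_zero)
      also have "(s powr (1 / \<alpha>) * d) powr \<alpha> = s * d powr \<alpha>"
        using s \<alpha> d by (simp add: powr_mult powr_powr)
      also have "s * d powr \<alpha> \<le> t powr \<alpha> \<longleftrightarrow> s \<le> t powr \<alpha> * d powr (- \<alpha>)"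
        using d by (simp add: powr_minus field_simps)
      finally show ?case by (simp add: d_def)
    qed
  qed measurable
  finally show ?thesis .
qed

lemma first_hitting_nonneg:
  "AE \<omega> in M. 0 \<le> first_hitting D t \<omega>"
  using stable_unbounded[of t]
proof eventually_elim
  case (elim \<omega>)
  then have "{s. 0 \<le> s \<and> D s \<omega> > t} \<noteq> {}" using of_nat_0_le_iff by blast
  then show ?case unfolding first_hitting_def by (rule cInf_greatest) auto
qed

text \<open>
  The paths of \<open>D\<close> are only known to be monotone, so \<open>{Y > s} \<subseteq> {D s \<le> t} \<subseteq> {Y \<ge> s}\<close> is all that
  holds up to null sets. It suffices for equality of the laws.
\<close>

lemma distr_first_hitting:
  assumes t: "t \<ge> 0" and Y: "first_hitting D t \<in> borel_measurable (completion M)"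
  shows "distr (completion M) borel (first_hitting D t) = distr M borel (\<lambda>\<omega>. t powr \<alpha> * D 1 \<omega> powr (- \<alpha>))"
proof (rule distr_eq_of_tails)
  note [measurable] = stable_measurable[of 1, simplified] Y
  interpret C: prob_space "completion M" by (rule prob_space_completion)
  show "prob_space M" "prob_space (completion M)" by (rule M, rule prob_space_completion)
  show "AE \<omega> in completion M. 0 \<le> first_hitting D t \<omega>"
    using first_hitting_nonneg by (rule AE_completion)
  show "AE \<omega> in M. 0 \<le> t powr \<alpha> * D 1 \<omega> powr (- \<alpha>)" by simp
  fix s :: real assume s: "s > 0"
  note [measurable] = stable_measurable[OF less_imp_le[OF s]]
  have eq: "\<P>(\<omega> in M. s \<le> t powr \<alpha> * D 1 \<omega> powr (- \<alpha>)) = C.prob {\<omega>\<in>space M. D s \<omega> \<le> t}"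
    unfolding prob_stable_le[OF s t, symmetric] by (rule measure_completion[symmetric]) measurable
  have ev: "{\<omega>\<in>space M. D s \<omega> \<le> t} \<in> C.events"
    by (rule sets_completionI_sets) measurable
  have "\<P>(\<omega> in completion M. s < first_hitting D t \<omega>) \<le> C.prob {\<omega>\<in>space M. D s \<omega> \<le> t}"
  proof (rule C.finite_measure_mono_AE[OF _ ev], intro AE_I2 impI)
    fix \<omega> assume \<omega>: "\<omega> \<in> {\<omega> \<in> space (completion M). s < first_hitting D t \<omega>}"
    have "\<not> D s \<omega> > t"
    proof
      assume "D s \<omega> > t"
      then have "first_hitting D t \<omega> \<le> s"
        unfolding first_hitting_def using s by (intro cInf_lower bdd_belowI[of _ 0]) auto
      then show False using \<omega> by simp
    qed
    then show "\<omega> \<in> {\<omega>\<in>space M. D s \<omega> \<le> t}" using \<omega> by simp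
  qed
  then show "\<P>(\<omega> in completion M. s < first_hitting D t \<omega>) \<le> \<P>(\<omega> in M. s \<le> t powr \<alpha> * D 1 \<omega> powr (- \<alpha>))"
    unfolding eq .
  have "AE \<omega> in completion M. D s \<omega> \<le> t \<longrightarrow> s \<le> first_hitting D t \<omega>"
    using AE_completion[OF stable_unbounded[of t]] AE_completion[OF stable_mono]
  proof eventually_elim
    case (elim \<omega>)
    have "s \<le> first_hitting D t \<omega>" if "D s \<omega> \<le> t"
      unfolding first_hitting_def
    proof (rule cInf_greatest)
      show "{s. 0 \<le> s \<and> D s \<omega> > t} \<noteq> {}" using elim(1) of_nat_0_le_iff by blast
      fix r assume r: "r \<in> {s. 0 \<le> s \<and> D s \<omega> > t}"
      show "s \<le> r"
      proof (rule ccontr)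
        assume "\<not> s \<le> r"
        then have "D r \<omega> \<le> D s \<omega>" using r s by (intro mono_onD[OF elim(2)]) auto
        then show False using r that by simp
      qed
    qed
    then show ?case by simp
  qed
  then have "C.prob {\<omega>\<in>space M. D s \<omega> \<le> t} \<le> \<P>(\<omega> in completion M. s \<le> first_hitting D t \<omega>)"
  proof (intro C.finite_measure_mono_AE)
    show "{\<omega> \<in> space (completion M). s \<le> first_hitting D t \<omega>} \<in> C.events" by measurable
  qed auto
  moreover have "\<P>(\<omega> in M. s < t powr \<alpha> * D 1 \<omega> powr (- \<alpha>)) \<le> \<P>(\<omega> in M. s \<le> t powr \<alpha> * D 1 \<omega> powr (- \<alpha>))"
    by (intro finite_measure_mono) auto
  ultimately show "\<P>(\<omega> in M. s < t powr \<alpha> * D 1 \<omega> powr (- \<alpha>)) \<le> \<P>(\<omega> in completion M. s \<le> first_hitting D t \<omega>)"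
    unfolding eq by simp
qed (use Y stable_measurable[of 1, simplified] in measurable)

lemma rpower_mult_nat: "t \<ge> 0 \<Longrightarrow> a \<noteq> 0 \<Longrightarrow> rpower t (a * real n) = (t powr a) ^ n"
  by (cases "t = 0") (auto simp: rpower_def powr_powr[symmetric] powr_realpow power_0_left)

text \<open>
  Expand \<open>exp (- c * W)\<close> and integrate termwise, using the moments of \<open>W\<close>; the result is the series
  of the Mittag-Leffler function. The exchange is justified because \<open>Gamma (\<alpha> * n + 1)\<close> outgrows
  every geometric sequence, whereas \<open>fact (N + r) / fact r \<le> fact N * 2 ^ (N + r)\<close>.
\<close>

lemma integral_hitting_power_exp:
  assumes c: "c \<ge> 0" and t: "t \<ge> 0"
  defines "W \<equiv> \<lambda>\<omega>. t powr \<alpha> * D 1 \<omega> powr (- \<alpha>)"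
  shows "integrable M (\<lambda>\<omega>. W \<omega> ^ N * exp (- c * W \<omega>))" (is ?int)
    and "(\<integral>\<omega>. W \<omega> ^ N * exp (- c * W \<omega>) \<partial>M) = fact N * rpower t (\<alpha> * real N) *
      mittag_leffler3 \<alpha> (\<alpha> * real N + 1) (real (Suc N)) (- c * rpower t \<alpha>)" (is ?eq)
proof -
  note [measurable] = stable_measurable[of 1, simplified]
  define \<tau> where "\<tau> = t powr \<alpha>"
  have \<tau>: "\<tau> \<ge> 0" by (simp add: \<tau>_def)
  have W0: "W \<omega> \<ge> 0" for \<omega> by (simp add: W_def)
  have Wm[measurable]: "W \<in> borel_measurable M" unfolding W_def by measurable
  have G: "Gamma (\<alpha> * real n + 1) > 0" for n using \<alpha> by (intro Gamma_real_pos add_nonneg_pos) auto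
  have "has_bochner_integral M (\<lambda>\<omega>. W \<omega> ^ n) (\<tau> ^ n * (fact n / Gamma (\<alpha> * real n + 1)))" for n
  proof (rule has_bochner_integral_nn_integral)
    have "(\<integral>\<^sup>+\<omega>. ennreal (W \<omega> ^ n) \<partial>M) = (\<integral>\<^sup>+\<omega>. ennreal (\<tau> ^ n) * ennreal ((D 1 \<omega> powr (- \<alpha>)) ^ n) \<partial>M)"
      using \<tau> by (simp add: W_def \<tau>_def[symmetric] power_mult_distrib ennreal_mult')
    also have "\<dots> = ennreal (\<tau> ^ n) * ennreal (fact n / Gamma (\<alpha> * real n + 1))"
      unfolding stable_inverse_moment[symmetric] by (rule nn_integral_cmult) measurable
    also have "\<dots> = ennreal (\<tau> ^ n * (fact n / Gamma (\<alpha> * real n + 1)))"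
      using \<tau> by (intro ennreal_mult'[symmetric]) simp
    finally show "(\<integral>\<^sup>+\<omega>. ennreal (W \<omega> ^ n) \<partial>M) = ennreal (\<tau> ^ n * (fact n / Gamma (\<alpha> * real n + 1)))" .
  qed (use W0 G[of n] \<tau> in \<open>auto intro!: mult_nonneg_nonneg divide_nonneg_pos\<close>)
  then have int: "integrable M (\<lambda>\<omega>. W \<omega> ^ n)"
    and val: "(\<integral>\<omega>. W \<omega> ^ n \<partial>M) = \<tau> ^ n * (fact n / Gamma (\<alpha> * real n + 1))" for n
    by (auto simp: has_bochner_integral_iff)
  show ?int
  proof (rule Bochner_Integration.integrable_bound[OF int[of N]])
    show "AE \<omega> in M. norm (W \<omega> ^ N * exp (- c * W \<omega>)) \<le> norm (W \<omega> ^ N)"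
      using W0 c by (intro AE_I2) (auto simp: abs_mult mult_left_le)
  qed measurable
  let ?f = "\<lambda>r \<omega>. (- c) ^ r / fact r * W \<omega> ^ (N + r)"
  have norm_f: "norm (?f r \<omega>) = c ^ r / fact r * W \<omega> ^ (N + r)" for r \<omega>
    using W0[of \<omega>] c by (simp add: abs_mult power_abs)
  have int_f: "integrable M (?f r)" for r by (intro integrable_mult_right int)
  have exp_f: "(\<Sum>r. ?f r \<omega>) = W \<omega> ^ N * exp (- c * W \<omega>)" for \<omega>
  proof -
    have "(\<lambda>r. W \<omega> ^ N * ((- c * W \<omega>) ^ r /\<^sub>R fact r)) sums (W \<omega> ^ N * exp (- c * W \<omega>))"
      by (intro sums_mult exp_converges)
    moreover have "(\<lambda>r. W \<omega> ^ N * ((- c * W \<omega>) ^ r /\<^sub>R fact r)) = (\<lambda>r. ?f r \<omega>)"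
      by (rule ext) (simp only: power_mult_distrib power_add real_scaleR_def divide_inverse mult_ac)
    ultimately show ?thesis by (simp add: sums_iff)
  qed
  have summ: "summable (\<lambda>r. \<integral>\<omega>. norm (?f r \<omega>) \<partial>M)"
  proof -
    \<comment> \<open>\<open>R = T powr \<alpha>\<close> is chosen so large that the ratio \<open>x\<close> of the majorant is less than 1.\<close>
    define R where "R = 4 * (c + 1) * (\<tau> + 1)"
    define T where "T = R powr (1 / \<alpha>)"
    have R: "R > 0" using c \<tau> by (simp add: R_def)
    have TR: "T powr (\<alpha> * real n) = R ^ n" for n
      using R \<alpha> by (simp add: T_def powr_powr powr_realpow)
    define K where "K = fact N * exp (T + 1) * (2 * \<tau> / R) ^ N"
    define x where "x = 2 * c * \<tau> / R"
    have x: "0 \<le> x" "x < 1"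
    proof -
      have "0 \<le> c * \<tau>" using c \<tau> by simp
      moreover have "R = 4 + 4 * \<tau> + 4 * c + 4 * (c * \<tau>)" by (simp add: R_def algebra_simps)
      ultimately have "2 * c * \<tau> < R" using c \<tau> by linarith
      then show "0 \<le> x" "x < 1" using c \<tau> R by (auto simp: x_def)
    qed
    have bound: "(\<integral>\<omega>. norm (?f r \<omega>) \<partial>M) \<le> K * x ^ r" for r
    proof -
      have "(\<integral>\<omega>. norm (?f r \<omega>) \<partial>M) = c ^ r / fact r * (\<tau> ^ (N + r) * (fact (N + r) / Gamma (\<alpha> * real (N + r) + 1)))"
        unfolding norm_f by (simp only: integral_mult_right_zero val)
      also have "\<dots> = c ^ r * \<tau> ^ (N + r) * (fact (N + r) / fact r) * (1 / Gamma (\<alpha> * real (N + r) + 1))"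
        by simp
      also have "\<dots> \<le> c ^ r * \<tau> ^ (N + r) * (fact N * 2 ^ (N + r)) * (exp (T + 1) / R ^ (N + r))"
      proof (intro mult_mono mult_nonneg_nonneg)
        have "fact N * fact r * ((N + r) choose N) = (fact (N + r) :: nat)"
          using binomial_fact_lemma[of N "N + r"] by simp
        then have "real (fact N * fact r * ((N + r) choose N)) = real (fact (N + r))"
          by (rule arg_cong)
        then have "(fact (N + r) :: real) / fact r = fact N * real ((N + r) choose N)"
          by (simp add: field_simps)
        moreover have "real ((N + r) choose N) \<le> 2 ^ (N + r)"
          using binomial_le_pow2[of "N + r" N] by (metis of_nat_le_iff of_nat_numeral of_nat_power)
        ultimately show "fact (N + r) / fact r \<le> (fact N * 2 ^ (N + r) :: real)" by simp
        have "R ^ (N + r) * exp (- (T + 1)) \<le> Gamma (\<alpha> * real (N + r) + 1)"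
          using Gamma_lower_bound[of "\<alpha> * real (N + r)" T] \<alpha> unfolding TR by (simp add: T_def)
        then have "R ^ (N + r) \<le> Gamma (\<alpha> * real (N + r) + 1) * exp (T + 1)"
          by (simp only: exp_minus inverse_eq_divide) (simp add: pos_divide_le_eq)
        then show "1 / Gamma (\<alpha> * real (N + r) + 1) \<le> exp (T + 1) / R ^ (N + r)"
          using G[of "N + r"] R by (simp add: divide_simps mult_ac)
      qed (use c \<tau> R G[of "N + r"] in \<open>auto simp: less_imp_le\<close>)
      also have "\<dots> = K * x ^ r"
        by (simp add: K_def x_def power_add power_mult_distrib power_divide mult_ac)
      finally show ?thesis .
    qed
    show ?thesis
    proof (rule summable_comparison_test')
      show "summable (\<lambda>r. K * x ^ r)" using x by (intro summable_mult summable_geometric) auto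
      fix r
      have "0 \<le> (\<integral>\<omega>. norm (?f r \<omega>) \<partial>M)" by (intro integral_nonneg_AE AE_I2 norm_ge_zero)
      then show "norm (\<integral>\<omega>. norm (?f r \<omega>) \<partial>M) \<le> K * x ^ r" using bound[of r] by (simp only: real_norm_def abs_of_nonneg)
    qed
  qed
  have "(\<lambda>r. integral\<^sup>L M (?f r)) sums (\<integral>\<omega>. (\<Sum>r. ?f r \<omega>) \<partial>M)"
  proof (rule sums_integral[OF int_f _ summ], rule AE_I2)
    fix \<omega>
    have "summable (\<lambda>r. W \<omega> ^ N * norm ((c * W \<omega>) ^ r /\<^sub>R fact r))"
      by (intro summable_mult summable_norm_exp)
    moreover have "W \<omega> ^ N * norm ((c * W \<omega>) ^ r /\<^sub>R fact r) = norm (?f r \<omega>)" for r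
      unfolding norm_f using c W0[of \<omega>]
      by (simp add: power_mult_distrib power_add abs_mult divide_inverse mult_ac)
    ultimately show "summable (\<lambda>r. norm (?f r \<omega>))" by (simp only:)
  qed
  then have series: "(\<lambda>r. integral\<^sup>L M (?f r)) sums (\<integral>\<omega>. W \<omega> ^ N * exp (- c * W \<omega>) \<partial>M)"
    unfolding exp_f .
  define g where "g r = Gamma (real (Suc N) + real r) * (- c * \<tau>) ^ r /
      (fact r * Gamma (real (Suc N)) * Gamma (\<alpha> * real r + (\<alpha> * real N + 1)))" for r
  have coeff: "integral\<^sup>L M (?f r) = (fact N * \<tau> ^ N) * g r" for r
  proof -
    have g1: "Gamma (real (Suc N) + real r) = fact (N + r)"
      by (simp add: Gamma_fact[symmetric] add_ac)
    have g2: "Gamma (real (Suc N)) = fact N" by (simp add: Gamma_fact[symmetric] add_ac)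
    have g3: "\<alpha> * real r + (\<alpha> * real N + 1) = \<alpha> * real (N + r) + 1" by (simp add: algebra_simps)
    have "integral\<^sup>L M (?f r) = (- c) ^ r / fact r * (\<tau> ^ (N + r) * (fact (N + r) / Gamma (\<alpha> * real (N + r) + 1)))"
      by (simp only: integral_mult_right_zero val)
    also have "\<dots> = (fact N * \<tau> ^ N) * (fact (N + r) * (- c * \<tau>) ^ r / (fact r * fact N * Gamma (\<alpha> * real (N + r) + 1)))"
      by (simp only: power_mult_distrib power_add) (simp add: divide_simps)
    finally show ?thesis unfolding g_def g1 g2 g3 .
  qed
  have "(\<lambda>r. (fact N * \<tau> ^ N) * g r) sums (\<integral>\<omega>. W \<omega> ^ N * exp (- c * W \<omega>) \<partial>M)"
    using series unfolding coeff .
  \<comment> \<open>For \<open>\<tau> = 0\<close> and \<open>N > 0\<close> the factor vanishes and nothing is known about \<open>g\<close>.\<close>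
  moreover have "(\<lambda>r. (fact N * \<tau> ^ N) * g r) sums ((fact N * \<tau> ^ N) * suminf g)"
  proof (cases "fact N * \<tau> ^ N = 0")
    case False
    then have "summable g"
      using series unfolding coeff by (intro summable_mult_D[OF sums_summable]) auto
    then show ?thesis by (intro sums_mult summable_sums)
  next
    case True
    show ?thesis unfolding True by simp
  qed
  ultimately have "(\<integral>\<omega>. W \<omega> ^ N * exp (- c * W \<omega>) \<partial>M) = fact N * \<tau> ^ N * suminf g"
    by (rule sums_unique2)
  also have "suminf g = mittag_leffler3 \<alpha> (\<alpha> * real N + 1) (real (Suc N)) (- c * rpower t \<alpha>)"
    using \<alpha> unfolding mittag_leffler3_def g_def by (simp add: rpower_def \<tau>_def)
  also have "\<tau> ^ N = rpower t (\<alpha> * real N)"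
    using \<alpha> t by (simp add: rpower_mult_nat \<tau>_def)
  finally show ?eq .
qed

end

section \<open>Jump processes at independent random times\<close>

text \<open>
  Approximate \<open>Y\<close> from above by \<open>Z n\<close>, the next point of the lattice of width \<open>1 / Suc n\<close>. As \<open>Z n\<close> has
  countably many values, independence gives the statement for it. Since \<open>Z n > Y\<close>, right-continuity
  of the paths makes \<open>X (Z n)\<close> eventually equal to \<open>X Y\<close>, and dominated convergence applies.
  Path regularity is almost sure only, so the limiting event is measurable up to null sets.
\<close>

lemma prob_at_independent_time:
  fixes M :: "'w measure" and X :: "real \<Rightarrow> 'w \<Rightarrow> 's" and Y :: "'w \<Rightarrow> real" and p :: "real \<Rightarrow> real"
  assumes M: "prob_space M"
    and X: "\<And>t. t \<ge> 0 \<Longrightarrow> {\<omega>\<in>space M. X t \<omega> = x} \<in> sets M"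
    and rc: "AE \<omega> in M. \<forall>t\<ge>0. \<forall>\<^sub>F s in at_right t. X s \<omega> = X t \<omega>"
    and Y[measurable]: "Y \<in> borel_measurable (completion M)"
    and nY: "AE \<omega> in M. 0 \<le> Y \<omega>"
    and p: "\<And>t. t \<ge> 0 \<Longrightarrow> \<P>(\<omega> in M. X t \<omega> = x) = p t"
    and cont: "continuous_on UNIV p"
    and indep: "\<And>t B. t \<ge> 0 \<Longrightarrow> B \<in> sets borel \<Longrightarrow>
      measure (completion M) ({\<omega>\<in>space M. Y \<omega> \<in> B} \<inter> {\<omega>\<in>space M. X t \<omega> = x}) =
      measure (completion M) {\<omega>\<in>space M. Y \<omega> \<in> B} * p t"
  shows "{\<omega>\<in>space M. X (Y \<omega>) \<omega> = x} \<in> sets (completion M)"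
    and "measure (completion M) {\<omega>\<in>space M. X (Y \<omega>) \<omega> = x} = (\<integral>\<omega>. p (Y \<omega>) \<partial>completion M)"
proof -
  interpret prob_space M by (rule M)
  interpret C: prob_space "completion M" by (rule prob_space_completion)
  have [measurable]: "p \<in> borel_measurable borel" using cont by (rule borel_measurable_continuous_onI)
  have p01: "0 \<le> p t" "p t \<le> 1" if "t \<ge> 0" for t
    unfolding p[OF that, symmetric] by (auto simp: measure_nonneg)
  \<comment> \<open>The summand 1 makes \<open>Z n > Y\<close> strict, also when \<open>Y\<close> is a lattice point.\<close>
  define j where "j n \<omega> = nat (\<lfloor>real (Suc n) * Y \<omega>\<rfloor> + 1)" for n \<omega>
  define Z where "Z n \<omega> = real (j n \<omega>) / real (Suc n)" for n \<omega>
  define E where "E n i = {\<omega>\<in>space M. X (real i / real (Suc n)) \<omega> = x}" for n and i :: nat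
  define A where "A n = {\<omega>\<in>space M. X (Z n \<omega>) \<omega> = x}" for n
  have jm[measurable]: "j n \<in> measurable (completion M) (count_space UNIV)" for n
    unfolding j_def by measurable
  have Zm[measurable]: "Z n \<in> borel_measurable (completion M)" for n
    unfolding Z_def by measurable
  have Z0: "0 \<le> Z n \<omega>" for n \<omega> by (simp add: Z_def)
  have EM: "E n i \<in> sets (completion M)" for n i unfolding E_def by (intro sets_completionI_sets X) simp
  have BM: "{\<omega>\<in>space M. j n \<omega> = i} \<in> sets (completion M)" for n i
    using measurable_sets[OF jm[of n], of "{i}"] by (simp add: vimage_def Int_def conj_commute)
  have A_UN: "A n = (\<Union>i. {\<omega>\<in>space M. j n \<omega> = i} \<inter> E n i)" for n
    by (auto simp: A_def E_def Z_def)
  have AM: "A n \<in> sets (completion M)" for n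
    unfolding A_UN by (intro sets.countable_UN) (auto intro!: sets.Int BM EM)
  have pr: "C.prob (A n) = (\<integral>\<omega>. p (Z n \<omega>) \<partial>completion M)" for n
  proof -
    have single: "(\<Sum>i. f i * indicator {\<omega>\<in>space M. j n \<omega> = i} \<omega>) = f (j n \<omega>)" if "\<omega> \<in> space M"
      for f :: "nat \<Rightarrow> ennreal" and \<omega>
      using that by (subst suminf_finite[of "{j n \<omega>}"]) auto
    have "emeasure (completion M) (A n) = (\<Sum>i. emeasure (completion M) ({\<omega>\<in>space M. j n \<omega> = i} \<inter> E n i))"
      unfolding A_UN
      by (intro suminf_emeasure[symmetric]) (auto simp: disjoint_family_on_def intro!: sets.Int BM EM)
    also have "\<dots> = (\<Sum>i. ennreal (p (real i / real (Suc n))) * emeasure (completion M) {\<omega>\<in>space M. j n \<omega> = i})"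
    proof (rule suminf_cong)
      fix i
      let ?B = "{y. nat (\<lfloor>real (Suc n) * y\<rfloor> + 1) = i}"
      have "?B = (\<lambda>y. nat (\<lfloor>real (Suc n) * y\<rfloor> + 1)) -` {i} \<inter> space borel" by auto
      also have "\<dots> \<in> sets borel" by (rule measurable_sets[where A="count_space UNIV"]) measurable
      finally have "?B \<in> sets borel" .
      from indep[OF _ this, of "real i / real (Suc n)"]
      have "C.prob ({\<omega>\<in>space M. j n \<omega> = i} \<inter> E n i) = C.prob {\<omega>\<in>space M. j n \<omega> = i} * p (real i / real (Suc n))"
        by (simp add: j_def E_def)
      then show "emeasure (completion M) ({\<omega>\<in>space M. j n \<omega> = i} \<inter> E n i) =
          ennreal (p (real i / real (Suc n))) * emeasure (completion M) {\<omega>\<in>space M. j n \<omega> = i}"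
        unfolding C.emeasure_eq_measure using p01(1)[of "real i / real (Suc n)"]
        by (simp add: ennreal_mult' mult.commute)
    qed
    also have "\<dots> = (\<Sum>i. \<integral>\<^sup>+\<omega>. ennreal (p (real i / real (Suc n))) * indicator {\<omega>\<in>space M. j n \<omega> = i} \<omega> \<partial>completion M)"
      by (intro suminf_cong nn_integral_cmult_indicator[symmetric] BM)
    also have "\<dots> = (\<integral>\<^sup>+\<omega>. (\<Sum>i. ennreal (p (real i / real (Suc n))) * indicator {\<omega>\<in>space M. j n \<omega> = i} \<omega>) \<partial>completion M)"
      using BM by (intro nn_integral_suminf[symmetric]) auto
    also have "\<dots> = (\<integral>\<^sup>+\<omega>. ennreal (p (Z n \<omega>)) \<partial>completion M)"
      by (intro nn_integral_cong) (simp add: single Z_def)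
    also have "\<dots> = ennreal (\<integral>\<omega>. p (Z n \<omega>) \<partial>completion M)"
      using p01 Z0 by (intro nn_integral_eq_integral C.integrable_const_bound[where B=1] AE_I2) auto
    finally show ?thesis
      using p01 Z0 by (simp add: C.emeasure_eq_measure integral_nonneg_AE)
  qed
  have Zlim: "filterlim (\<lambda>n. Z n \<omega>) (at_right (Y \<omega>)) sequentially" if "0 \<le> Y \<omega>" for \<omega>
  proof -
    have Zeq: "Z n \<omega> = (real_of_int \<lfloor>real (Suc n) * Y \<omega>\<rfloor> + 1) / real (Suc n)" for n
      using that by (simp add: Z_def j_def)
    have gt: "Y \<omega> < Z n \<omega>" for n
      unfolding Zeq by (subst pos_less_divide_eq) (simp_all add: mult.commute)
    have le: "Z n \<omega> \<le> Y \<omega> + 1 / real (Suc n)" for n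
    proof -
      have "(real_of_int \<lfloor>real (Suc n) * Y \<omega>\<rfloor> + 1) / real (Suc n) \<le> (real (Suc n) * Y \<omega> + 1) / real (Suc n)"
        by (intro divide_right_mono add_right_mono of_int_floor_le) simp
      also have "\<dots> = Y \<omega> + 1 / real (Suc n)" by (simp add: add_divide_distrib del: of_nat_Suc)
      finally show ?thesis unfolding Zeq .
    qed
    have "(\<lambda>n. Y \<omega> + 1 / real (Suc n)) \<longlonglongrightarrow> Y \<omega> + 0"
      by (intro tendsto_add tendsto_const LIMSEQ_Suc[OF lim_1_over_n])
    then have "(\<lambda>n. Y \<omega> + 1 / real (Suc n)) \<longlonglongrightarrow> Y \<omega>" by simp
    then have "(\<lambda>n. Z n \<omega>) \<longlonglongrightarrow> Y \<omega>"
      by (rule tendsto_sandwich[rotated 2, OF tendsto_const]) (intro always_eventually allI le less_imp_le[OF gt])+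
    then show ?thesis
      unfolding filterlim_at using gt by (auto intro!: always_eventually simp: less_imp_neq[symmetric])
  qed
  define L where "L = {\<omega>\<in>space M. \<exists>N. \<forall>n\<ge>N. \<omega> \<in> A n}"
  define AY where "AY = {\<omega>\<in>space M. X (Y \<omega>) \<omega> = x}"
  have LM: "L \<in> sets (completion M)"
  proof -
    have "L = (\<Union>N. \<Inter>n\<in>{N..}. A n)" unfolding L_def A_def by auto
    also have "\<dots> \<in> sets (completion M)"
      by (intro sets.countable_UN image_subsetI sets.countable_INT) (auto intro!: AM)
    finally show ?thesis .
  qed
  have ev: "AE \<omega> in M. \<forall>\<^sub>F n in sequentially. \<omega> \<in> A n \<longleftrightarrow> \<omega> \<in> AY"
    using rc nY
  proof eventually_elim
    case (elim \<omega>)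
    then have "\<forall>\<^sub>F s in at_right (Y \<omega>). X s \<omega> = X (Y \<omega>) \<omega>" by blast
    then have "\<forall>\<^sub>F n in sequentially. X (Z n \<omega>) \<omega> = X (Y \<omega>) \<omega>"
      using Zlim[OF elim(2)] unfolding filterlim_iff by blast
    then show ?case by eventually_elim (auto simp: A_def AY_def)
  qed
  have AL: "AE \<omega> in M. \<not> (\<omega> \<in> AY \<longleftrightarrow> \<omega> \<notin> L)"
    using ev AE_space
  proof eventually_elim
    case (elim \<omega>)
    then obtain N where N: "\<And>n. n \<ge> N \<Longrightarrow> \<omega> \<in> A n \<longleftrightarrow> \<omega> \<in> AY"
      by (auto simp: eventually_sequentially)
    have "\<omega> \<in> L \<longleftrightarrow> \<omega> \<in> AY"
    proof
      assume "\<omega> \<in> L"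
      then obtain N' where "\<And>n. n \<ge> N' \<Longrightarrow> \<omega> \<in> A n" by (auto simp: L_def)
      then have "\<omega> \<in> A (max N N')" by simp
      then show "\<omega> \<in> AY" using N[of "max N N'"] by simp
    next
      assume "\<omega> \<in> AY"
      then show "\<omega> \<in> L" using N elim(2) by (auto simp: L_def intro!: exI[of _ N])
    qed
    then show ?case by simp
  qed
  have AY_sets: "AY \<in> sets (completion M)"
  proof -
    have "Measurable.pred (completion M) (\<lambda>\<omega>. \<omega> \<in> AY \<longleftrightarrow> \<omega> \<notin> L)" using AL by (rule sets_completion_AE)
    then have B: "{\<omega>\<in>space M. \<omega> \<in> AY \<longleftrightarrow> \<omega> \<notin> L} \<in> sets (completion M)" (is "?B \<in> _")
      by (simp add: pred_def)
    have "(?B - L) \<union> (L - ?B) \<in> sets (completion M)" by (intro sets.Un sets.Diff B LM)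
    also have "(?B - L) \<union> (L - ?B) = AY" by (auto simp: L_def AY_def)
    finally show ?thesis .
  qed
  then show "{\<omega>\<in>space M. X (Y \<omega>) \<omega> = x} \<in> sets (completion M)" by (simp add: AY_def)
  have "(\<lambda>n. \<integral>\<omega>. indicator (A n) \<omega> \<partial>completion M) \<longlonglongrightarrow> (\<integral>\<omega>. indicator AY \<omega> \<partial>completion M :: real)"
  proof (rule integral_dominated_convergence[where w="\<lambda>_. 1"])
    show "AE \<omega> in completion M. (\<lambda>n. indicator (A n) \<omega>) \<longlonglongrightarrow> (indicator AY \<omega> :: real)"
      using AE_completion[OF ev]
    proof eventually_elim
      case (elim \<omega>)
      then have "\<forall>\<^sub>F n in sequentially. indicator (A n) \<omega> = (indicator AY \<omega> :: real)"
        by eventually_elim (simp add: indicator_def)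
      then show ?case by (rule tendsto_eventually)
    qed
  qed (use AM AY_sets in \<open>auto simp: indicator_def\<close>)
  moreover have "space M \<inter> A n = A n" "space M \<inter> AY = AY" for n
    by (auto simp: A_def AY_def)
  ultimately have "(\<lambda>n. C.prob (A n)) \<longlonglongrightarrow> C.prob AY"
    by (simp add: Int_commute)
  moreover have "(\<lambda>n. \<integral>\<omega>. p (Z n \<omega>) \<partial>completion M) \<longlonglongrightarrow> (\<integral>\<omega>. p (Y \<omega>) \<partial>completion M)"
  proof (rule integral_dominated_convergence[where w="\<lambda>_. 1"])
    show "AE \<omega> in completion M. (\<lambda>n. p (Z n \<omega>)) \<longlonglongrightarrow> p (Y \<omega>)"
      using AE_completion[OF nY]
    proof eventually_elim
      case (elim \<omega>)
      have "(\<lambda>n. Z n \<omega>) \<longlonglongrightarrow> Y \<omega>" using Zlim[OF elim] by (simp add: filterlim_at)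
      then show ?case by (rule continuous_on_tendsto_compose[OF cont]) auto
    qed
    show "AE \<omega> in completion M. norm (p (Z n \<omega>)) \<le> 1" for n
      using p01 Z0 by (intro AE_I2) auto
  qed auto
  ultimately have "C.prob AY = (\<integral>\<omega>. p (Y \<omega>) \<partial>completion M)"
    unfolding pr by (rule LIMSEQ_unique)
  then show "measure (completion M) {\<omega>\<in>space M. X (Y \<omega>) \<omega> = x} = (\<integral>\<omega>. p (Y \<omega>) \<partial>completion M)"
    by (simp add: AY_def)
qed

section \<open>The time-changed queue\<close>

lemma finite_weak_compositions: "finite (weak_compositions l n)"
proof (rule finite_subset)
  show "weak_compositions l n \<subseteq> {1..l} \<rightarrow>\<^sub>E {..n}"
  proof
    fix m assume m: "m \<in> weak_compositions l n"
    have "m j \<le> n" if "j \<in> {1..l}" for j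
      using m member_le_sum[of j "{1..l}" m] that by (auto simp: weak_compositions_def)
    then show "m \<in> {1..l} \<rightarrow>\<^sub>E {..n}" using m by (auto simp: weak_compositions_def PiE_iff)
  qed
qed (auto intro: finite_PiE)

lemma profile_weight_nonneg:
  assumes "0 \<le> \<nu>" "\<And>j. j \<in> {1..l} \<Longrightarrow> 0 \<le> lam j"
  shows "0 \<le> profile_weight k l \<nu> lam h m"
  unfolding profile_weight_def Let_def using assms
  by (intro divide_nonneg_pos mult_nonneg_nonneg prod_nonneg zero_le_power ballI) auto

text \<open>
  A triple \<open>(h, n, m)\<close> contributes to the weight for exactly one \<open>N\<close>, namely \<open>\<gamma> - 1\<close>. The terms are
  nonnegative, so the family of all of them is summable and may be grouped by \<open>N\<close> or by \<open>h\<close>.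
\<close>

lemma regroup_series:
  fixes e :: "nat \<Rightarrow> real"
  assumes \<nu>: "0 \<le> \<nu>" and lam: "\<And>j. j \<in> {1..l} \<Longrightarrow> 0 \<le> lam j" and e: "\<And>N. 0 \<le> e N"
    and Z: "(\<lambda>N. idle_weight k l \<nu> lam N 0 * e N) sums Z"
  defines "F \<equiv> \<lambda>h n m. profile_weight k l \<nu> lam h m * e (gamma0 k l h n m - 1)"
  shows "(\<forall>h\<ge>1. summable (\<lambda>n. \<Sum>m\<in>weak_compositions l n. F h n m)) \<and>
    (\<lambda>i. \<Sum>n. \<Sum>m\<in>weak_compositions l n. F (Suc i) n m) sums Z"
proof -
  note T0 = profile_weight_nonneg[OF \<nu> lam]
  have F0: "0 \<le> F h n m" for h n m unfolding F_def by (intro mult_nonneg_nonneg T0 e)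
  let ?I = "\<lambda>N. Sigma {0<..Suc N} (\<lambda>h. arrival_profiles k l h N)"
  let ?f = "\<lambda>(N, h, m). profile_weight k l \<nu> lam h m * e N"
  have inner: "((\<lambda>y. ?f (N, y)) has_sum idle_weight k l \<nu> lam N 0 * e N) (?I N)" for N
  proof (rule has_sum_finiteI)
    show "finite (?I N)" by (intro finite_SigmaI finite_arrival_profiles) auto
    have "idle_weight k l \<nu> lam N 0 * e N = (\<Sum>h\<in>{0<..Suc N}. \<Sum>m\<in>arrival_profiles k l h N. profile_weight k l \<nu> lam h m * e N)"
      by (simp add: idle_weight_eq_sum_first_passage first_passage_weight_def sum_distrib_right)
    also have "\<dots> = sum (\<lambda>y. ?f (N, y)) (?I N)"
      by (subst sum.Sigma) (auto simp: finite_arrival_profiles)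
    finally show "idle_weight k l \<nu> lam N 0 * e N = sum (\<lambda>y. ?f (N, y)) (?I N)" .
  qed
  have outer: "((\<lambda>N. idle_weight k l \<nu> lam N 0 * e N) has_sum Z) UNIV"
    using Z by (rule sums_nonneg_imp_has_sum) (intro mult_nonneg_nonneg idle_weight_nonneg \<nu> lam e)
  have "(?f has_sum Z) (Sigma UNIV ?I)"
  proof (rule has_sum_SigmaI[OF inner outer])
    show "?f summable_on Sigma UNIV ?I"
      using outer by (intro summable_on_SigmaI[OF inner]) (auto simp: summable_on_def intro!: mult_nonneg_nonneg T0 e)
  qed
  also have "(?f has_sum Z) (Sigma UNIV ?I) \<longleftrightarrow>
      ((\<lambda>(h, n, m). F h n m) has_sum Z) (Sigma {1..} (\<lambda>h. Sigma UNIV (weak_compositions l)))"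
    by (rule has_sum_reindex_bij_witness[where
          i="\<lambda>(h, n, m). (gamma0 k l h n m - 1, h, m)" and j="\<lambda>(N, h, m). (h, \<Sum>j=1..l. m j, m)"])
       (auto simp: arrival_profiles_def F_def weak_compositions_def gamma0_def PiE_iff extensional_def)
  finally have all: "((\<lambda>(h, n, m). F h n m) has_sum Z) (Sigma {1..} (\<lambda>h. Sigma UNIV (weak_compositions l)))" .
  define S where "S h = infsum (\<lambda>(n, m). F h n m) (Sigma UNIV (weak_compositions l))" for h
  have each: "((\<lambda>(n, m). F h n m) has_sum S h) (Sigma UNIV (weak_compositions l))" if "h \<ge> 1" for h
  proof -
    have "(\<lambda>(h, y). (\<lambda>(n, m). F h n m) y) summable_on Sigma {1..} (\<lambda>h. Sigma UNIV (weak_compositions l))"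
      using all by (auto simp: summable_on_def)
    from summable_on_SigmaD1[OF this, of h] that show ?thesis
      unfolding S_def by (intro has_sum_infsum) auto
  qed
  have row: "(\<lambda>n. \<Sum>m\<in>weak_compositions l n. F h n m) sums S h" if "h \<ge> 1" for h
  proof (rule has_sum_imp_sums, rule has_sum_SigmaD[OF each[OF that]])
    fix n
    show "((\<lambda>y. (\<lambda>(n, m). F h n m) (n, y)) has_sum (\<Sum>m\<in>weak_compositions l n. F h n m)) (weak_compositions l n)"
      by (rule has_sum_finiteI) (auto simp: finite_weak_compositions)
  qed
  have "(S has_sum Z) {1..}"
    by (rule has_sum_SigmaD[OF all]) (use each in auto)
  also have "(S has_sum Z) {1..} \<longleftrightarrow> ((\<lambda>i. S (Suc i)) has_sum Z) UNIV"
    by (rule has_sum_reindex_bij_witness[where i=Suc and j="\<lambda>h. h - 1"]) auto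
  finally have "(\<lambda>i. S (Suc i)) sums Z" by (rule has_sum_imp_sums)
  moreover have "(\<Sum>n. \<Sum>m\<in>weak_compositions l n. F (Suc i) n m) = S (Suc i)" for i
    using row[of "Suc i"] by (simp add: sums_iff)
  ultimately show ?thesis using row by (auto simp: sums_iff)
qed

lemma erlang_queue_idle_probability:
  fixes M :: "'w measure"
  assumes M: "prob_space M" and k: "k \<ge> 1" and \<mu>: "\<mu> > 0" and lam: "\<And>j. j \<in> {1..l} \<Longrightarrow> 0 < lam j"
    and Q: "erlang_queue M k l \<mu> lam Q" and t: "t \<ge> 0"
  shows "\<P>(\<omega> in M. Q t \<omega> = (0, 0)) =
    exp (- ((\<Sum>j=1..l. lam j) + real k * \<mu>) * t) * idle_series k l (real k * \<mu>) lam 0 t"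
proof -
  interpret prob_space M by (rule M)
  have meas: "{\<omega>\<in>space M. Q s \<omega> = (0, 0)} \<in> events" if "s \<ge> 0" for s
  proof -
    have "Q s \<in> measurable M (count_space (erlang_states k))"
      using Q that by (auto simp: erlang_queue_def markov_jump_process_def)
    from measurable_sets[OF this, of "{(0, 0)}"] show ?thesis
      by (simp add: erlang_states_def vimage_def Int_def conj_commute)
  qed
  have Q0: "AE \<omega> in M. Q 0 \<omega> = (0, 0)"
    using Q by (auto simp: erlang_queue_def markov_jump_process_def)
  obtain P where P: "transition_semigroup (erlang_states k) P"
      "has_transition_rates (erlang_states k) (erlang_rate k l \<mu> lam) P"
    and law: "\<And>(n::nat) (\<tau>::nat \<Rightarrow> real) x h y.
           0 \<le> \<tau> 0 \<and> strict_mono \<tau> \<and> 0 \<le> h \<and> \<P>(\<omega> in M. \<forall>i\<le>n. Q (\<tau> i) \<omega> = x i) > 0 \<longrightarrow>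
           \<P>(\<omega> in M. Q (\<tau> n + h) \<omega> = y \<bar> \<forall>i\<le>n. Q (\<tau> i) \<omega> = x i) = pmf (P h (x n)) y"
    using Q unfolding erlang_queue_def markov_jump_process_def by blast
  have one: "\<P>(\<omega> in M. Q 0 \<omega> = (0, 0)) = 1"
    using Q0 meas[of 0] by (subst prob_Collect_eq_1) auto
  have "\<P>(\<omega> in M. Q t \<omega> = (0, 0) \<bar> Q 0 \<omega> = (0, 0)) = pmf (P t (0, 0)) (0, 0)"
    using law[of real t 0 "\<lambda>_. (0, 0)" "(0, 0)"] t one by (simp add: strict_mono_def)
  moreover have "\<P>(\<omega> in M. Q t \<omega> = (0, 0) \<bar> Q 0 \<omega> = (0, 0)) = \<P>(\<omega> in M. Q t \<omega> = (0, 0))"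
  proof -
    have "\<P>(\<omega> in M. Q t \<omega> = (0, 0) \<and> Q 0 \<omega> = (0, 0)) = \<P>(\<omega> in M. Q t \<omega> = (0, 0))"
    proof (rule finite_measure_eq_AE)
      show "AE \<omega> in M. \<omega> \<in> {\<omega> \<in> space M. Q t \<omega> = (0, 0) \<and> Q 0 \<omega> = (0, 0)} \<longleftrightarrow> \<omega> \<in> {\<omega> \<in> space M. Q t \<omega> = (0, 0)}"
        using Q0 by eventually_elim simp
      have "{\<omega> \<in> space M. Q t \<omega> = (0, 0) \<and> Q 0 \<omega> = (0, 0)} =
          {\<omega> \<in> space M. Q t \<omega> = (0, 0)} \<inter> {\<omega> \<in> space M. Q 0 \<omega> = (0, 0)}" by auto
      then show "{\<omega> \<in> space M. Q t \<omega> = (0, 0) \<and> Q 0 \<omega> = (0, 0)} \<in> events"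
        using meas[OF t] meas[of 0] by auto
    qed (rule meas[OF t])
    then show ?thesis by (simp add: cond_prob_def one)
  qed
  ultimately show ?thesis using erlang_idle_probability[OF k \<mu> lam P t] by simp
qed

lemma first_hitting_0:
  assumes M: "prob_space M" and D: "stable_subordinator M \<alpha> D" and \<alpha>: "0 < \<alpha>"
  shows "AE \<omega> in M. first_hitting D 0 \<omega> = 0"
proof -
  have "AE \<omega> in M. \<forall>n. 0 < D (1 / real (Suc n)) \<omega>"
    by (subst AE_all_countable) (intro allI stable_pos[OF M D \<alpha>], simp)
  then show ?thesis
  proof eventually_elim
    case (elim \<omega>)
    let ?S = "{s. 0 \<le> s \<and> D s \<omega> > 0}"
    have mem: "1 / real (Suc n) \<in> ?S" for n using elim by simp
    have "Inf ?S \<le> 1 / real (Suc n)" for n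
      using mem by (intro cInf_lower bdd_belowI[of _ 0]) auto
    moreover have "(\<lambda>n. 1 / real (Suc n)) \<longlonglongrightarrow> 0" by (intro LIMSEQ_Suc[OF lim_1_over_n])
    ultimately have "Inf ?S \<le> 0" by (intro LIMSEQ_le_const) auto
    moreover have "0 \<le> Inf ?S" using mem by (intro cInf_greatest) blast+
    ultimately show ?case by (simp add: first_hitting_def)
  qed
qed

text \<open>
  The condition in \<open>zero_state_prob\<close> holds almost surely, because \<open>D s > 0\<close> for \<open>s > 0\<close> makes the
  first hitting time vanish at time 0.
\<close>

lemma zero_state_prob_time_change:
  fixes M :: "'w measure" and Q :: "real \<Rightarrow> 'w \<Rightarrow> nat \<times> nat"
  assumes M: "prob_space M" and D: "stable_subordinator M \<alpha> D" and \<alpha>: "0 < \<alpha>"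
    and Q: "markov_jump_process M S q (0, 0) Q" and S: "(0, 0) \<in> S"
    and ind: "independent_processes M borel (first_hitting D) (count_space UNIV) Q"
    and p: "\<And>t. t \<ge> 0 \<Longrightarrow> \<P>(\<omega> in M. Q t \<omega> = (0, 0)) = p t"
    and cont: "continuous_on UNIV p" and t: "t \<ge> 0"
  shows "zero_state_prob M (time_change Q (first_hitting D)) t =
    (\<integral>\<omega>. p (t powr \<alpha> * D 1 \<omega> powr (- \<alpha>)) \<partial>M)"
proof -
  interpret prob_space M by (rule M)
  interpret C: prob_space "completion M" by (rule prob_space_completion)
  let ?Y = "first_hitting D"
  have meas: "{\<omega>\<in>space M. Q s \<omega> = (0, 0)} \<in> events" if "s \<ge> 0" for s
  proof -
    have "Q s \<in> measurable M (count_space S)" using Q that by (auto simp: markov_jump_process_def)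
    from measurable_sets[OF this, of "{(0, 0)}"] show ?thesis
      by (simp add: S vimage_def Int_def conj_commute)
  qed
  have Q0: "AE \<omega> in M. Q 0 \<omega> = (0, 0)" using Q by (auto simp: markov_jump_process_def)
  have rc: "AE \<omega> in M. \<forall>t\<ge>0. \<forall>\<^sub>F s in at_right t. Q s \<omega> = Q t \<omega>"
    using Q by (auto simp: markov_jump_process_def)
  have indep: "C.indep_set (process_events M borel ?Y) (process_events M (count_space UNIV) Q)"
    using ind unfolding independent_processes_def .
  have evY: "{\<omega>\<in>space M. ?Y s \<omega> \<in> B} \<in> process_events M borel ?Y" if "s \<ge> 0" "B \<in> sets borel" for s B
  proof -
    have "{\<omega>\<in>space M. ?Y s \<omega> \<in> B} = ?Y s -` B \<inter> space M" by auto
    then show ?thesis unfolding process_events_def using that by (intro sigma_sets.Basic) auto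
  qed
  have evQ: "{\<omega>\<in>space M. Q s \<omega> = (0, 0)} \<in> process_events M (count_space UNIV) Q" if "s \<ge> 0" for s
  proof -
    have "{\<omega>\<in>space M. Q s \<omega> = (0, 0)} = Q s -` {(0, 0)} \<inter> space M" by auto
    then show ?thesis unfolding process_events_def using that by (intro sigma_sets.Basic) auto
  qed
  have Ym[measurable]: "?Y t \<in> borel_measurable (completion M)"
  proof (rule measurableI)
    fix B :: "real set" assume "B \<in> sets borel"
    then have "{\<omega>\<in>space M. ?Y t \<omega> \<in> B} \<in> C.events"
      using evY[OF t] C.indep_setD_ev1[OF indep] by blast
    then show "?Y t -` B \<inter> space (completion M) \<in> C.events"
      by (simp add: vimage_def Int_def conj_commute)
  qed simp
  have "C.prob ({\<omega>\<in>space M. ?Y t \<omega> \<in> B} \<inter> {\<omega>\<in>space M. Q s \<omega> = (0, 0)}) =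
      C.prob {\<omega>\<in>space M. ?Y t \<omega> \<in> B} * p s" if "s \<ge> 0" "B \<in> sets borel" for s B
    using C.indep_setD[OF indep evY[OF t that(2)] evQ[OF that(1)]] p[OF that(1)] meas[OF that(1)] by simp
  note at_time = prob_at_independent_time[OF M meas rc Ym first_hitting_nonneg[OF M D \<alpha>] p cont this]
  have start: "AE \<omega> in completion M. Q (?Y 0 \<omega>) \<omega> = (0, 0)"
    using AE_completion[OF first_hitting_0[OF M D \<alpha>]] AE_completion[OF Q0]
    by eventually_elim simp
  have start_ev: "{\<omega>\<in>space M. Q (?Y 0 \<omega>) \<omega> = (0, 0)} \<in> C.events"
  proof -
    have "AE \<omega> in M. \<not> (Q (?Y 0 \<omega>) \<omega> \<noteq> (0, 0))" using start by (simp add: AE_completion_iff)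
    then have "Measurable.pred (completion M) (\<lambda>\<omega>. Q (?Y 0 \<omega>) \<omega> \<noteq> (0, 0))" by (rule sets_completion_AE)
    then have "{\<omega>\<in>space M. Q (?Y 0 \<omega>) \<omega> \<noteq> (0, 0)} \<in> C.events" by (simp add: pred_def)
    then have "space M - {\<omega>\<in>space M. Q (?Y 0 \<omega>) \<omega> \<noteq> (0, 0)} \<in> C.events"
      using sets.compl_sets by fastforce
    also have "space M - {\<omega>\<in>space M. Q (?Y 0 \<omega>) \<omega> \<noteq> (0, 0)} = {\<omega>\<in>space M. Q (?Y 0 \<omega>) \<omega> = (0, 0)}"
      by blast
    finally show ?thesis .
  qed
  have one: "C.prob {\<omega>\<in>space M. Q (?Y 0 \<omega>) \<omega> = (0, 0)} = 1"
    using start start_ev by (subst C.prob_eq_1) auto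
  have "C.prob {\<omega>\<in>space M. Q (?Y t \<omega>) \<omega> = (0, 0) \<and> Q (?Y 0 \<omega>) \<omega> = (0, 0)}
      = C.prob {\<omega>\<in>space M. Q (?Y t \<omega>) \<omega> = (0, 0)}"
  proof (rule C.finite_measure_eq_AE)
    have "{\<omega>\<in>space M. Q (?Y t \<omega>) \<omega> = (0, 0) \<and> Q (?Y 0 \<omega>) \<omega> = (0, 0)} =
        {\<omega>\<in>space M. Q (?Y t \<omega>) \<omega> = (0, 0)} \<inter> {\<omega>\<in>space M. Q (?Y 0 \<omega>) \<omega> = (0, 0)}" by auto
    then show "{\<omega>\<in>space M. Q (?Y t \<omega>) \<omega> = (0, 0) \<and> Q (?Y 0 \<omega>) \<omega> = (0, 0)} \<in> C.events"
      using sets.Int[OF at_time(1) start_ev] by (simp only:)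
    show "AE \<omega> in completion M.
        \<omega> \<in> {\<omega>\<in>space M. Q (?Y t \<omega>) \<omega> = (0, 0) \<and> Q (?Y 0 \<omega>) \<omega> = (0, 0)} \<longleftrightarrow>
        \<omega> \<in> {\<omega>\<in>space M. Q (?Y t \<omega>) \<omega> = (0, 0)}"
      using start by eventually_elim simp
  qed (rule at_time(1))
  then have "zero_state_prob M (time_change Q ?Y) t = C.prob {\<omega>\<in>space M. Q (?Y t \<omega>) \<omega> = (0, 0)}"
    by (simp add: zero_state_prob_def time_change_def cond_prob_def one)
  also have "\<dots> = (\<integral>\<omega>. p (?Y t \<omega>) \<partial>completion M)" by (rule at_time(2))
  also have "\<dots> = (\<integral>y. p y \<partial>distr (completion M) borel (?Y t))"
    using borel_measurable_continuous_onI[OF cont] by (intro integral_distr[symmetric]) auto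
  also have "\<dots> = (\<integral>y. p y \<partial>distr M borel (\<lambda>\<omega>. t powr \<alpha> * D 1 \<omega> powr (- \<alpha>)))"
    by (simp only: distr_first_hitting[OF M D \<alpha> t Ym])
  also have "\<dots> = (\<integral>\<omega>. p (t powr \<alpha> * D 1 \<omega> powr (- \<alpha>)) \<partial>M)"
    using borel_measurable_continuous_onI[OF cont] stable_measurable[OF M D \<alpha>, of 1]
    by (intro integral_distr) auto
  finally show ?thesis .
qed

theorem theorem3p2:
  fixes M :: "'w measure"
    and k l :: nat
    and \<mu> \<alpha> t :: real
    and lam :: "nat \<Rightarrow> real"
    and Q :: "real \<Rightarrow> 'w \<Rightarrow> nat \<times> nat"
    and D :: "real \<Rightarrow> 'w \<Rightarrow> real"
  assumes "prob_space M"
    and "k \<ge> 1" and "l \<ge> 1"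
    and "\<mu> > 0" and "\<forall>m\<in>{1..l}. lam m > 0"
    and "0 < \<alpha>" and "\<alpha> < 1"
    and "erlang_queue M k l \<mu> lam Q"
    and "stable_subordinator M \<alpha> D"
    and "independent_processes M borel (first_hitting D) (count_space UNIV) Q"
    and "t \<ge> 0"
  shows "(\<forall>h\<ge>1. summable (\<lambda>n. \<Sum>m\<in>weak_compositions l n. term0 k l \<mu> lam \<alpha> t h n m)) \<and>
    (\<lambda>i. \<Sum>n. \<Sum>m\<in>weak_compositions l n. term0 k l \<mu> lam \<alpha> t (Suc i) n m)
      sums zero_state_prob M (time_change Q (first_hitting D)) t"
proof -
  interpret prob_space M by fact
  define L where "L = (\<Sum>j=1..l. lam j)"
  define \<nu> where "\<nu> = real k * \<mu>"
  define c where "c = L + \<nu>"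
  define W where "W \<omega> = t powr \<alpha> * D 1 \<omega> powr (- \<alpha>)" for \<omega>
  define e where "e N = (\<integral>\<omega>. W \<omega> ^ N * exp (- c * W \<omega>) \<partial>M) / fact N" for N
  define p where "p s = exp (- c * s) * idle_series k l \<nu> lam 0 s" for s
  define Z where "Z = zero_state_prob M (time_change Q (first_hitting D)) t"
  have lam: "0 \<le> lam j" if "j \<in> {1..l}" for j using assms(5) that by (simp add: less_imp_le)
  have \<nu>: "0 \<le> \<nu>" using assms by (simp add: \<nu>_def)
  have L: "L > 0" unfolding L_def using assms(3,5) by (intro sum_pos) auto
  have c: "c \<ge> 0" using L \<nu> by (simp add: c_def)
  have W0: "0 \<le> W \<omega>" for \<omega> by (simp add: W_def)
  note [measurable] = stable_measurable[OF assms(1,9,6), of 1, simplified]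
  have [measurable]: "W \<in> borel_measurable M" unfolding W_def by measurable
  have series_cont: "continuous_on UNIV (idle_series k l \<nu> lam 0)"
    by (intro DERIV_continuous_on[OF idle_series_has_derivative[OF \<nu> lam, THEN has_field_derivative_at_within]])
  have p_cont: "continuous_on UNIV p"
    unfolding p_def by (intro continuous_intros series_cont)
  have Z: "Z = (\<integral>\<omega>. p (W \<omega>) \<partial>M)"
    unfolding Z_def W_def
  proof (rule zero_state_prob_time_change[OF assms(1,9,6) _ _ assms(10) _ p_cont assms(11)])
    show "markov_jump_process M (erlang_states k) (erlang_rate k l \<mu> lam) (0, 0) Q"
      using assms(8) unfolding erlang_queue_def .
    show "(0, 0) \<in> erlang_states k" by (simp add: erlang_states_def)
    fix s :: real assume "s \<ge> 0"
    then show "\<P>(\<omega> in M. Q s \<omega> = (0, 0)) = p s"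
      unfolding p_def c_def L_def \<nu>_def using assms
      by (intro erlang_queue_idle_probability) auto
  qed
  let ?f = "\<lambda>N \<omega>. idle_weight k l \<nu> lam N 0 / fact N * (W \<omega> ^ N * exp (- c * W \<omega>))"
  have int: "integrable M (\<lambda>\<omega>. W \<omega> ^ N * exp (- c * W \<omega>))" for N
    unfolding W_def by (rule integral_hitting_power_exp[OF assms(1,9,6) c assms(11)])
  have f0: "0 \<le> ?f N \<omega>" for N \<omega>
    using W0 by (intro mult_nonneg_nonneg divide_nonneg_pos idle_weight_nonneg \<nu> lam) auto
  have f_sums: "(\<lambda>N. ?f N \<omega>) sums p (W \<omega>)" for \<omega>
    using sums_mult[OF summable_sums[OF summable_idle_series[OF \<nu> lam, where k=k and i=0 and t="W \<omega>"]], where c="exp (- c * W \<omega>)"]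
    by (simp add: p_def idle_series_def mult_ac)
  have p1: "0 \<le> p s" "p s \<le> 1" if s: "s \<ge> 0" for s
  proof -
    have "p s \<le> exp (- c * s) * exp (c * s)"
      unfolding p_def using idle_series_bounds(2)[OF \<nu> lam s, where k=k and i=0]
      by (intro mult_left_mono) (auto simp: c_def L_def add.commute)
    also have "\<dots> = 1" by (simp add: mult_exp_exp)
    finally show "p s \<le> 1" .
    show "0 \<le> p s" unfolding p_def using idle_series_bounds(1)[OF \<nu> lam s] by simp
  qed
  have int_f: "integrable M (?f N)" for N by (intro integrable_mult_right int)
  have int_p: "integrable M (\<lambda>\<omega>. p (W \<omega>))"
    using p1 W0 borel_measurable_continuous_onI[OF p_cont]
    by (intro integrable_const_bound[where B=1] AE_I2) auto
  have norm_f: "norm (?f N \<omega>) = ?f N \<omega>" for N \<omega> using f0[of N \<omega>] by (simp only: real_norm_def abs_of_nonneg)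
  have "(\<lambda>N. integral\<^sup>L M (?f N)) sums (\<integral>\<omega>. (\<Sum>N. ?f N \<omega>) \<partial>M)"
  proof (rule sums_integral[OF int_f])
    show "AE \<omega> in M. summable (\<lambda>N. norm (?f N \<omega>))"
      unfolding norm_f using f_sums by (intro AE_I2 sums_summable)
    \<comment> \<open>The partial sums are at most the integral of \<open>p (W \<omega>)\<close>, which is a probability.\<close>
    show "summable (\<lambda>N. \<integral>\<omega>. norm (?f N \<omega>) \<partial>M)"
      unfolding norm_f
    proof (rule summableI_nonneg_bounded)
      show "0 \<le> integral\<^sup>L M (?f N)" for N by (intro integral_nonneg_AE AE_I2 f0)
      fix n
      have "(\<Sum>N<n. integral\<^sup>L M (?f N)) = (\<integral>\<omega>. (\<Sum>N<n. ?f N \<omega>) \<partial>M)"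
        by (rule Bochner_Integration.integral_sum[symmetric]) (rule int_f)
      also have "\<dots> \<le> (\<integral>\<omega>. p (W \<omega>) \<partial>M)"
      proof (rule integral_mono)
        show "(\<Sum>N<n. ?f N \<omega>) \<le> p (W \<omega>)" for \<omega>
          using sum_le_suminf[OF sums_summable[OF f_sums], of "{..<n}" \<omega>] f0
          by (simp only: sums_unique[OF f_sums, symmetric]) simp
      qed (intro Bochner_Integration.integrable_sum int_f int_p)+
      finally show "(\<Sum>N<n. integral\<^sup>L M (?f N)) \<le> (\<integral>\<omega>. p (W \<omega>) \<partial>M)" .
    qed
  qed
  moreover have "integral\<^sup>L M (?f N) = idle_weight k l \<nu> lam N 0 * e N" for N
    unfolding e_def by (simp only: integral_mult_right_zero) simp
  moreover have "(\<Sum>N. ?f N \<omega>) = p (W \<omega>)" for \<omega> using f_sums by (rule sums_unique[symmetric])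
  ultimately have series: "(\<lambda>N. idle_weight k l \<nu> lam N 0 * e N) sums Z" unfolding Z by (simp only:)
  have e0: "0 \<le> e N" for N
    unfolding e_def using W0 by (intro divide_nonneg_pos integral_nonneg_AE AE_I2 mult_nonneg_nonneg) auto
  have term0_eq: "term0 k l \<mu> lam \<alpha> t h n m = profile_weight k l \<nu> lam h m * e (gamma0 k l h n m - 1)"
    if "h \<ge> 1" "m \<in> weak_compositions l n" for h n m
  proof -
    have "gamma0 k l h n m \<noteq> 0" using that(1) by (simp add: gamma0_def)
    then obtain N where N: "gamma0 k l h n m = Suc N" using not0_implies_Suc by blast
    have "coeff0 k l \<mu> lam h n m = profile_weight k l \<nu> lam h m"
      unfolding \<nu>_def using that L by (intro coeff0_eq_profile_weight) (auto simp: weak_compositions_def L_def)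
    moreover have "beta0 k l \<alpha> h n m = \<alpha> * real N + 1" by (simp add: beta0_def N)
    moreover have "e N = rpower t (\<alpha> * real N) *
        mittag_leffler3 \<alpha> (\<alpha> * real N + 1) (real (Suc N)) (- c * rpower t \<alpha>)"
      unfolding e_def W_def integral_hitting_power_exp(2)[OF assms(1,9,6) c assms(11)] by simp
    ultimately show ?thesis by (simp add: term0_def N c_def L_def \<nu>_def)
  qed
  show ?thesis
    using regroup_series[OF \<nu> lam e0 series] unfolding Z_def
    by (simp add: term0_eq cong: sum.cong)
qed

end
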